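(* Let $(\Omega,\mathcal{A},P_0)$ be a probability space with $P_0$ $\sigma$-additive, and let $L$ be a convex cone of real bounded random variables on it. Let $\mathbb{S}$ be the (possibly empty) set of equivalent super-martingale finitely additive probabilities for $L$, and let $\mathcal{Q}$ be the set of $\sigma$-additive probabilities $Q$ on $\mathcal{A}$ with $Q\sim P_0$. Each of the following conditions is equivalent to $\mathbb{S}\neq\emptyset$: (a) $\overline{L-L_\infty^+}\,\cap L_\infty^+=\{0\}$, where the closure is taken in the norm-topology of $L_\infty$; (b) there are $Q\in\mathcal{Q}$ and a constant $k\geq 0$ such that $E_Q(X)\leq k\,\operatorname{ess\,sup}(-X)$ for each $X\in L$; (c) there are events $A_n\in\mathcal{A}$ and constants $k_n\geq 0$, $n\geq 1$, such that $\lim_n P_0(A_n)=1$ and $E_{P_0}\{X\,I_{A_n}\}\leq k_n\,\operatorname{ess\,sup}(-X)$ for all $n\geq 1$ and $X\in L$; (d) $\{P_0(X\in\cdot):\,X\in L,\ X\geq -1\ P_0\text{-a.s.}\}$ is a tight collection of probability laws on $\mathbb{R}$. Moreover, if condition (b) holds with a given $Q\in\mathcal{Q}$ and $k\geq 0$, then there is a finitely additive probability $P_1$ on $\mathcal{A}$ such that $$P=\frac{Q+k\,P_1}{1+k}\in\mathbb{S}.$$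
   Context: A real random variable is an $\mathcal{A}$-measurable function $\Omega\to\mathbb{R}$. A set $L$ of real random variables is a convex cone if $\sum_{j=1}^n\lambda_jX_j\in L$ for all $n\geq 1$, $\lambda_1,\ldots,\lambda_n\geq 0$ and $X_1,\ldots,X_n\in L$. $L_\infty=L_\infty(\Omega,\mathcal{A},P_0)$, and $L_\infty^+$ is the set of its ($P_0$-a.s.) non-negative elements. Since its elements are bounded, $L$ is identified with a subset of $L_\infty$; $L-L_\infty^+=\{X-Z:X\in L,\,Z\in L_\infty^+\}$. For a real random variable $X$, $\operatorname{ess\,sup}(X)=\inf\{x\in\mathbb{R}:P_0(X>x)=0\}$, with $\inf\emptyset=\infty$. $I_A$ is the indicator function of $A$. $\mathbb{P}$ denotes the set of finitely additive probabilities on $\mathcal{A}$. For $P,T\in\mathbb{P}$, $P\ll T$ means that $P(A)=0$ whenever $A\in\mathcal{A}$ and $T(A)=0$; $P\sim T$ means $P\ll T$ and $T\ll P$. For $P\in\mathbb{P}$ and $X$ a bounded random variable, $E_P(X)=\int X\,dP$ is the usual integral of a bounded measurable function with respect to a finitely additive probability (the sup-norm continuous linear extension of the integral from simple functions). An equivalent super-martingale finitely additive probability (ESFA) for $L$ (where $L$ consists of bounded random variables) is $P\in\mathbb{P}$ such that $P\sim P_0$ and $E_P(X)\leq 0$ for each $X\in L$. *)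

theory Defs
  imports "HOL-Probability.Probability"
begin

text \<open>
  Random variables on a probability space \<^term>\<open>M\<close> are functions on the whole carrier type; only
  their values on \<^term>\<open>space M\<close> matter. The empty set satisfies this definition, a nonempty
  convex cone contains the zero function.
\<close>

definition rv_convex_cone :: "('a \<Rightarrow> real) set \<Rightarrow> bool" where
  "rv_convex_cone L \<longleftrightarrow>
     (\<forall>n\<ge>1::nat. \<forall>l :: nat \<Rightarrow> real. \<forall>X :: nat \<Rightarrow> 'a \<Rightarrow> real.
        (\<forall>j\<in>{1..n}. 0 \<le> l j \<and> X j \<in> L) \<longrightarrow> (\<lambda>\<omega>. \<Sum>j=1..n. l j * X j \<omega>) \<in> L)"


subsection \<open>Finitely additive probabilities and their integral\<close>

text \<open>Values of \<^term>\<open>P\<close> outside \<^term>\<open>sets M\<close> are irrelevant.\<close>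

definition fa_prob :: "'a measure \<Rightarrow> ('a set \<Rightarrow> real) \<Rightarrow> bool" where
  "fa_prob M P \<longleftrightarrow> (\<forall>A\<in>sets M. 0 \<le> P A) \<and> P (space M) = 1 \<and> additive (sets M) P"

definition fa_abs_cont :: "'a measure \<Rightarrow> ('a set \<Rightarrow> real) \<Rightarrow> ('a set \<Rightarrow> real) \<Rightarrow> bool" where
  "fa_abs_cont M P T \<longleftrightarrow> (\<forall>A\<in>sets M. T A = 0 \<longrightarrow> P A = 0)"

definition fa_equiv :: "'a measure \<Rightarrow> ('a set \<Rightarrow> real) \<Rightarrow> ('a set \<Rightarrow> real) \<Rightarrow> bool" where
  "fa_equiv M P T \<longleftrightarrow> fa_abs_cont M P T \<and> fa_abs_cont M T P"

definition fa_simple_integral :: "'a measure \<Rightarrow> ('a set \<Rightarrow> real) \<Rightarrow> ('a \<Rightarrow> real) \<Rightarrow> real" where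
  "fa_simple_integral M P f = (\<Sum>y\<in>f ` space M. y * P {\<omega>\<in>space M. f \<omega> = y})"

text \<open>
  The sup-norm continuous extension of the integral of simple functions. For a finitely additive
  probability \<^term>\<open>P\<close> and a bounded measurable \<^term>\<open>f\<close> the value exists and does
  not depend on the approximating sequence; see \<open>has_fa_integral_fa_integral\<close> and
  \<open>fa_integral_eqI\<close> below.
\<close>

definition has_fa_integral ::
    "'a measure \<Rightarrow> ('a set \<Rightarrow> real) \<Rightarrow> ('a \<Rightarrow> real) \<Rightarrow> real \<Rightarrow> bool" where
  "has_fa_integral M P f r \<longleftrightarrow>
     (\<exists>s :: nat \<Rightarrow> 'a \<Rightarrow> real. (\<forall>n. simple_function M (s n)) \<and>
        uniform_limit (space M) s f sequentially \<and>
        (\<lambda>n. fa_simple_integral M P (s n)) \<longlonglongrightarrow> r)"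

definition fa_integral :: "'a measure \<Rightarrow> ('a set \<Rightarrow> real) \<Rightarrow> ('a \<Rightarrow> real) \<Rightarrow> real" where
  "fa_integral M P f = (THE r. has_fa_integral M P f r)"

lemma fa_prob_measure:
  assumes "prob_space Q" "sets Q = sets M"
  shows "fa_prob M (measure Q)"
proof -
  interpret prob_space Q by fact
  have "space Q = space M" using assms(2) by (rule sets_eq_imp_space_eq)
  then show ?thesis
    using prob_space finite_measure_Union assms(2)
    by (auto simp: fa_prob_def additive_def)
qed

lemma fa_prob_sum_UN:
  assumes P: "fa_prob M P" and I: "finite I" and A: "\<And>i. i \<in> I \<Longrightarrow> A i \<in> sets M"
    and d: "disjoint_family_on A I"
  shows "P (\<Union>i\<in>I. A i) = (\<Sum>i\<in>I. P (A i))"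
  using I A d
proof (induction I)
  case empty
  have "P ({} \<union> {}) = P {} + P {}"
    using P unfolding fa_prob_def additive_def by blast
  then show ?case by simp
next
  case (insert i I)
  have "A i \<inter> (\<Union>j\<in>I. A j) = {}"
    using insert.prems(2) insert.hyps(2) by (fastforce simp: disjoint_family_on_def)
  moreover have "(\<Union>j\<in>I. A j) \<in> sets M"
    using insert by (intro sets.finite_UN) auto
  ultimately have "P (A i \<union> (\<Union>j\<in>I. A j)) = P (A i) + P (\<Union>j\<in>I. A j)"
    using P insert.prems(1)[of i] unfolding fa_prob_def additive_def by blast
  moreover have "P (\<Union>j\<in>I. A j) = (\<Sum>j\<in>I. P (A j))"
    using insert by (auto simp: disjoint_family_on_def)
  ultimately show ?case using insert.hyps by simp
qed

lemma fa_simple_integral_partition: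
  assumes P: "fa_prob M P" and g: "simple_function M g"
    and fg: "\<And>\<omega>. \<omega> \<in> space M \<Longrightarrow> f \<omega> = v (g \<omega>)"
  shows "fa_simple_integral M P f = (\<Sum>z\<in>g ` space M. v z * P {\<omega>\<in>space M. g \<omega> = z})"
proof -
  let ?G = "\<lambda>z. {\<omega>\<in>space M. g \<omega> = z}"
  have fin: "finite (g ` space M)" and G: "\<And>z. ?G z \<in> sets M"
  proof -
    show "finite (g ` space M)" using g by (rule simple_functionD)
    show "?G z \<in> sets M" for z
    proof -
      have "?G z = g -` {z} \<inter> space M" by auto
      then show ?thesis using simple_functionD(2)[OF g] by metis
    qed
  qed
  have fim: "f ` space M = v ` (g ` space M)"
    unfolding image_image by (rule image_cong) (auto simp: fg)
  have *: "P {\<omega>\<in>space M. f \<omega> = y} = (\<Sum>z\<in>{z\<in>g ` space M. v z = y}. P (?G z))" for y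
  proof -
    have "{\<omega>\<in>space M. f \<omega> = y} = (\<Union>z\<in>{z\<in>g ` space M. v z = y}. ?G z)"
      using fg by auto
    then show ?thesis
      using fa_prob_sum_UN[OF P, of "{z\<in>g ` space M. v z = y}" ?G] fin G
      by (auto simp: disjoint_family_on_def)
  qed
  have "fa_simple_integral M P f
      = (\<Sum>y\<in>v ` (g ` space M). \<Sum>z\<in>{z\<in>g ` space M. v z = y}. v z * P (?G z))"
    unfolding fa_simple_integral_def * fim by (auto simp: sum_distrib_left intro!: sum.cong)
  also have "\<dots> = (\<Sum>z\<in>g ` space M. v z * P (?G z))"
    using fin by (intro sum.group) auto
  finally show ?thesis .
qed

lemma fa_simple_integral_diff_le:
  assumes P: "fa_prob M P" and s: "simple_function M s" and t: "simple_function M t"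
    and e: "\<And>\<omega>. \<omega> \<in> space M \<Longrightarrow> \<bar>s \<omega> - t \<omega>\<bar> \<le> e"
  shows "\<bar>fa_simple_integral M P s - fa_simple_integral M P t\<bar> \<le> e"
proof -
  let ?g = "\<lambda>\<omega>. (s \<omega>, t \<omega>)"
  let ?G = "\<lambda>z. {\<omega>\<in>space M. ?g \<omega> = z}"
  have g: "simple_function M ?g" using s t by (rule simple_function_Pair)
  have fin: "finite (?g ` space M)" using g by (rule simple_functionD)
  have G: "?G z \<in> sets M" for z
  proof -
    have "?G z = ?g -` {z} \<inter> space M" by auto
    then show ?thesis using simple_functionD(2)[OF g] by metis
  qed
  have tot: "(\<Sum>z\<in>?g ` space M. P (?G z)) = 1"
  proof -
    have "(\<Union>z\<in>?g ` space M. ?G z) = space M" by auto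
    moreover have "P (\<Union>z\<in>?g ` space M. ?G z) = (\<Sum>z\<in>?g ` space M. P (?G z))"
      by (rule fa_prob_sum_UN[OF P fin G]) (auto simp: disjoint_family_on_def)
    ultimately have "P (space M) = (\<Sum>z\<in>?g ` space M. P (?G z))" by simp
    then show ?thesis using P by (simp add: fa_prob_def)
  qed
  have "fa_simple_integral M P s - fa_simple_integral M P t
      = (\<Sum>z\<in>?g ` space M. (fst z - snd z) * P (?G z))"
    using fa_simple_integral_partition[OF P g, of s fst]
      fa_simple_integral_partition[OF P g, of t snd]
    by (simp add: sum_subtractf left_diff_distrib)
  also have "\<bar>\<dots>\<bar> \<le> (\<Sum>z\<in>?g ` space M. \<bar>(fst z - snd z) * P (?G z)\<bar>)"
    by (rule sum_abs)
  also have "\<dots> \<le> (\<Sum>z\<in>?g ` space M. e * P (?G z))"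
  proof (rule sum_mono)
    fix z assume "z \<in> ?g ` space M"
    then have "\<bar>fst z - snd z\<bar> \<le> e" using e by auto
    moreover have "0 \<le> P (?G z)" using P G by (auto simp: fa_prob_def)
    ultimately show "\<bar>(fst z - snd z) * P (?G z)\<bar> \<le> e * P (?G z)"
      by (simp add: abs_mult mult_right_mono)
  qed
  also have "\<dots> = e" using tot by (simp flip: sum_distrib_left)
  finally show ?thesis .
qed

lemma has_fa_integral_unique:
  assumes P: "fa_prob M P" and r: "has_fa_integral M P f r" and r': "has_fa_integral M P f r'"
  shows "r = r'"
proof -
  obtain s where s: "\<And>n. simple_function M (s n)" "uniform_limit (space M) s f sequentially"
    "(\<lambda>n. fa_simple_integral M P (s n)) \<longlonglongrightarrow> r"
    using r unfolding has_fa_integral_def by auto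
  obtain t where t: "\<And>n. simple_function M (t n)" "uniform_limit (space M) t f sequentially"
    "(\<lambda>n. fa_simple_integral M P (t n)) \<longlonglongrightarrow> r'"
    using r' unfolding has_fa_integral_def by auto
  let ?d = "\<lambda>n. fa_simple_integral M P (s n) - fa_simple_integral M P (t n)"
  have "?d \<longlonglongrightarrow> 0"
  proof (rule tendstoI)
    fix e :: real assume e: "0 < e"
    have "\<forall>\<^sub>F n in sequentially. \<forall>\<omega>\<in>space M. dist (s n \<omega>) (f \<omega>) < e / 3"
      using s(2) e unfolding uniform_limit_iff by (meson zero_less_divide_iff zero_less_numeral)
    moreover have "\<forall>\<^sub>F n in sequentially. \<forall>\<omega>\<in>space M. dist (t n \<omega>) (f \<omega>) < e / 3"
      using t(2) e unfolding uniform_limit_iff by (meson zero_less_divide_iff zero_less_numeral)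
    ultimately show "\<forall>\<^sub>F n in sequentially. dist (?d n) 0 < e"
    proof eventually_elim
      case (elim n)
      have "\<bar>?d n\<bar> \<le> 2 * e / 3"
      proof (rule fa_simple_integral_diff_le[OF P s(1) t(1)])
        fix \<omega> assume "\<omega> \<in> space M"
        then have "\<bar>s n \<omega> - f \<omega>\<bar> < e / 3" "\<bar>t n \<omega> - f \<omega>\<bar> < e / 3"
          using elim by (auto simp: dist_real_def)
        then show "\<bar>s n \<omega> - t n \<omega>\<bar> \<le> 2 * e / 3" by linarith
      qed
      then show ?case using e by (simp add: dist_real_def)
    qed
  qed
  moreover have "?d \<longlonglongrightarrow> r - r'" using s(3) t(3) by (rule tendsto_diff)
  ultimately show ?thesis using LIMSEQ_unique by fastforce
qed

lemma has_fa_integral_exists: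
  assumes P: "fa_prob M P" and f: "f \<in> borel_measurable M" and b: "bounded (f ` space M)"
  shows "\<exists>r. has_fa_integral M P f r"
proof -
  define s :: "nat \<Rightarrow> _ \<Rightarrow> real" where
    "s n \<omega> = real_of_int \<lfloor>real (Suc n) * f \<omega>\<rfloor> / real (Suc n)" for n \<omega>
  have close: "\<bar>s n \<omega> - f \<omega>\<bar> \<le> 1 / real (Suc n)" for n \<omega>
  proof -
    have "s n \<omega> - f \<omega> = (real_of_int \<lfloor>real (Suc n) * f \<omega>\<rfloor> - real (Suc n) * f \<omega>) / real (Suc n)"
      by (simp add: s_def field_simps)
    moreover have "\<bar>real_of_int \<lfloor>real (Suc n) * f \<omega>\<rfloor> - real (Suc n) * f \<omega>\<bar> \<le> 1" by linarith
    ultimately show ?thesis by (simp add: abs_divide divide_right_mono)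
  qed
  have simp: "simple_function M (s n)" for n
  proof -
    obtain c where c: "\<And>\<omega>. \<omega> \<in> space M \<Longrightarrow> \<bar>f \<omega>\<bar> \<le> c"
      using b unfolding bounded_iff by auto
    have "(\<lambda>\<omega>. \<lfloor>real (Suc n) * f \<omega>\<rfloor>) ` space M
        \<subseteq> {\<lfloor>- (real (Suc n) * c)\<rfloor>..\<lfloor>real (Suc n) * c\<rfloor>}"
    proof safe
      fix \<omega> assume "\<omega> \<in> space M"
      then have "\<bar>real (Suc n) * f \<omega>\<bar> \<le> real (Suc n) * c"
        using c by (simp add: abs_mult mult_left_mono del: of_nat_Suc)
      then have "- (real (Suc n) * c) \<le> real (Suc n) * f \<omega>" "real (Suc n) * f \<omega> \<le> real (Suc n) * c"
        by linarith+
      then show "\<lfloor>real (Suc n) * f \<omega>\<rfloor> \<in> {\<lfloor>- (real (Suc n) * c)\<rfloor>..\<lfloor>real (Suc n) * c\<rfloor>}"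
        by (simp add: floor_mono del: of_nat_Suc)
    qed
    then have "finite ((\<lambda>\<omega>. \<lfloor>real (Suc n) * f \<omega>\<rfloor>) ` space M)"
      by (rule finite_subset) simp
    then have "finite ((\<lambda>i. real_of_int i / real (Suc n)) ` (\<lambda>\<omega>. \<lfloor>real (Suc n) * f \<omega>\<rfloor>) ` space M)"
      by simp
    then have "finite (s n ` space M)" unfolding image_image s_def .
    moreover have "s n \<in> borel_measurable M" using f unfolding s_def by measurable
    ultimately show ?thesis by (rule simple_function_borel_measurable[rotated])
  qed
  have lim: "(\<lambda>n. 1 / real (Suc n)) \<longlonglongrightarrow> 0"
    using LIMSEQ_inverse_real_of_nat by (simp add: inverse_eq_divide)
  have "uniform_limit (space M) s f sequentially"
    unfolding uniform_limit_iff
  proof safe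
    fix e :: real assume "0 < e"
    then have "\<forall>\<^sub>F n in sequentially. 1 / real (Suc n) < e" by (rule order_tendstoD(2)[OF lim])
    then show "\<forall>\<^sub>F n in sequentially. \<forall>\<omega>\<in>space M. dist (s n \<omega>) (f \<omega>) < e"
      by eventually_elim (use close in \<open>auto simp: dist_real_def intro: le_less_trans\<close>)
  qed
  moreover have "Cauchy (\<lambda>n. fa_simple_integral M P (s n))"
  proof (rule metric_CauchyI)
    fix e :: real assume e: "0 < e"
    then have "\<forall>\<^sub>F n in sequentially. 1 / real (Suc n) < e / 2"
      by (intro order_tendstoD(2)[OF lim]) simp
    then obtain N where N: "\<And>n. n \<ge> N \<Longrightarrow> 1 / real (Suc n) < e / 2"
      unfolding eventually_sequentially by blast
    have "dist (fa_simple_integral M P (s m)) (fa_simple_integral M P (s n)) < e"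
      if mn: "m \<ge> N" "n \<ge> N" for m n
    proof -
      have "\<bar>fa_simple_integral M P (s m) - fa_simple_integral M P (s n)\<bar>
          \<le> 1 / real (Suc m) + 1 / real (Suc n)"
      proof (rule fa_simple_integral_diff_le[OF P simp simp])
        fix \<omega>
        show "\<bar>s m \<omega> - s n \<omega>\<bar> \<le> 1 / real (Suc m) + 1 / real (Suc n)"
          using close[of m \<omega>] close[of n \<omega>] by linarith
      qed
      then show ?thesis using N[OF mn(1)] N[OF mn(2)] by (simp add: dist_real_def)
    qed
    then show "\<exists>N. \<forall>m\<ge>N. \<forall>n\<ge>N.
        dist (fa_simple_integral M P (s m)) (fa_simple_integral M P (s n)) < e" by blast
  qed
  ultimately show ?thesis
    using simp unfolding has_fa_integral_def Cauchy_convergent_iff convergent_def by blast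
qed

lemma fa_integral_eqI:
  assumes "fa_prob M P" "has_fa_integral M P f r"
  shows "fa_integral M P f = r"
  unfolding fa_integral_def using assms has_fa_integral_unique by (intro the_equality) blast+

lemma has_fa_integral_fa_integral:
  assumes "fa_prob M P" "f \<in> borel_measurable M" "bounded (f ` space M)"
  shows "has_fa_integral M P f (fa_integral M P f)"
  using has_fa_integral_exists[OF assms] fa_integral_eqI[OF assms(1)] by metis


subsection \<open>Equivalent super-martingale probabilities\<close>

definition ESFA :: "'a measure \<Rightarrow> ('a \<Rightarrow> real) set \<Rightarrow> ('a set \<Rightarrow> real) set" where
  "ESFA M L = {P. fa_prob M P \<and> fa_equiv M P (measure M) \<and> (\<forall>X\<in>L. fa_integral M P X \<le> 0)}"

definition equiv_probs :: "'a measure \<Rightarrow> 'a measure set" where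
  "equiv_probs M = {Q. prob_space Q \<and> sets Q = sets M \<and> fa_equiv M (measure Q) (measure M)}"


subsection \<open>The space $L_\infty$\<close>

text \<open>
  Functions represent their a.s. classes: every set below except \<^term>\<open>L\<close> itself is closed under
  a.s. equality, including \<^term>\<open>Linfty_minus_pos M L\<close>, since null functions can be absorbed into
  the subtracted term. In particular \<^term>\<open>Linfty_zero M\<close> is the zero element of the quotient, and
  \<^term>\<open>Linfty_closure M S\<close> represents the closure of the classes of \<^term>\<open>S\<close>.
\<close>

definition Linfty_norm :: "'a measure \<Rightarrow> ('a \<Rightarrow> real) \<Rightarrow> ereal" where
  "Linfty_norm M f = esssup M (\<lambda>\<omega>. ereal \<bar>f \<omega>\<bar>)"

definition Linfty :: "'a measure \<Rightarrow> ('a \<Rightarrow> real) set" where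
  "Linfty M = {f \<in> borel_measurable M. Linfty_norm M f < \<infinity>}"

definition Linfty_pos :: "'a measure \<Rightarrow> ('a \<Rightarrow> real) set" where
  "Linfty_pos M = {f \<in> Linfty M. AE \<omega> in M. 0 \<le> f \<omega>}"

definition Linfty_zero :: "'a measure \<Rightarrow> ('a \<Rightarrow> real) set" where
  "Linfty_zero M = {f \<in> Linfty M. AE \<omega> in M. f \<omega> = 0}"

definition Linfty_minus_pos :: "'a measure \<Rightarrow> ('a \<Rightarrow> real) set \<Rightarrow> ('a \<Rightarrow> real) set" where
  "Linfty_minus_pos M L = {(\<lambda>\<omega>. X \<omega> - Z \<omega>) | X Z. X \<in> L \<and> Z \<in> Linfty_pos M}"

definition Linfty_closure :: "'a measure \<Rightarrow> ('a \<Rightarrow> real) set \<Rightarrow> ('a \<Rightarrow> real) set" where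
  "Linfty_closure M S =
     {f \<in> Linfty M. \<forall>e>0. \<exists>g\<in>S. Linfty_norm M (\<lambda>\<omega>. f \<omega> - g \<omega>) < ereal e}"


subsection \<open>Tightness\<close>

text \<open>\<^const>\<open>tight\<close> covers only sequences of laws.\<close>

definition tight_laws :: "real measure set \<Rightarrow> bool" where
  "tight_laws \<Gamma> \<longleftrightarrow>
     (\<forall>\<mu>\<in>\<Gamma>. real_distribution \<mu>) \<and>
     (\<forall>e::real. e > 0 \<longrightarrow> (\<exists>K. compact K \<and> (\<forall>\<mu>\<in>\<Gamma>. measure \<mu> K > 1 - e)))"

end

theory Submission
  imports Defs
begin

text \<open>
  The conditions are linked in one cycle: a super-martingale probability exists
  \<open>\<Longrightarrow>\<close> (a) \<open>\<Longrightarrow>\<close> (d) \<open>\<Longrightarrow>\<close> (c) \<open>\<Longrightarrow>\<close> (b) \<open>\<Longrightarrow>\<close> a super-martingale probability exists. The last step is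
  the additional statement on mixtures of \<open>Q\<close> and \<open>P\<^sub>1\<close>.

  The two steps that produce a measure rest on one form of the Hahn--Banach theorem: given a sublinear
  functional \<open>r\<close> and a convex cone of constraints \<open>\<phi> f \<le> c\<close>, a linear \<open>\<phi> \<le> r\<close> that meets all
  constraints exists as soon as no single constraint contradicts \<open>r\<close>, that is, \<open>r (- f) + c \<ge> 0\<close>.

  \<^item> From (b) to a super-martingale probability (\<open>dominated_by_esssup_imp_ESFA\<close>): take the essential
    supremum for \<open>r\<close> and the constraints \<open>k * \<phi> X \<le> - E\<^sub>Q X\<close>. Condition (b) says precisely that
    these do not contradict \<open>r\<close>. A linear functional below the essential supremum is the integral
    for a finitely additive probability \<open>P\<^sub>1\<close> that vanishes on null sets, and the constraints say
    that \<open>(Q + k P\<^sub>1) / (1 + k)\<close> has nonpositive expectation on \<open>L\<close>.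

  \<^item> From (d) to (c) (\<open>convex_bounded_in_probability_localization\<close>): take \<open>r f = E (max 0 f)\<close>. Linear
    functionals below \<open>r\<close> are automatically \<open>\<sigma>\<close>-additive, so they have densities \<open>g\<close>. Tightness says
    that, up to a probability \<open>e\<close>, each \<open>1 + X\<close> with \<open>X \<ge> -1\<close> is at most \<open>b\<close>, and then the
    constraints \<open>\<phi> (1 + X) \<le> b\<close> and \<open>\<phi> 1 \<ge> 1 - e\<close> are compatible with \<open>r\<close>. The event where
    \<open>g \<ge> 1/2\<close> is the desired event; it is large because \<open>\<phi> 1\<close> is almost \<open>1\<close>.

  From (a) to (d) (\<open>closure_trivial_imp_bounded_in_probability\<close>): if tightness fails, rescaling
  unbounded elements of the cone gives truncations \<open>g \<le> X \<in> L\<close> whose negative parts are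
  arbitrarily small while their means stay above \<open>e/2\<close>. Such \<open>g\<close> form a decreasing sequence of
  convex sets, and near-minimizers of the \<open>L\<^sup>2\<close> norm in these sets converge almost surely. On some
  event of positive probability they are eventually bounded below by a positive constant, and this
  produces a nonzero nonnegative element of the closure in (a).

  From (c) to (b), the measures with densities the indicators of \<open>A\<^sub>n\<close> are added with weights that
  make the constants summable. The step from a super-martingale probability \<open>P\<close> to (a) is direct:
  an element \<open>f\<close> of the closure satisfies \<open>f \<le> X + e\<close> with \<open>X \<in> L\<close>, so \<open>P\<close>
  gives every event \<open>f \<ge> c > 0\<close> the mass \<open>0\<close>, and \<open>P\<^sub>0\<close> does too by equivalence.
\<close>

section \<open>A Hahn--Banach theorem with linear constraints\<close>

text \<open>
  Vector spaces of real functions are given by their carrier, since the spaces needed below depend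
  on a measure and so do not form a type.
\<close>

definition function_space :: "('a \<Rightarrow> real) set \<Rightarrow> bool" where
  "function_space V \<longleftrightarrow> (\<lambda>_. 0) \<in> V \<and> (\<forall>f\<in>V. \<forall>g\<in>V. (\<lambda>x. f x + g x) \<in> V) \<and>
     (\<forall>f\<in>V. \<forall>c. (\<lambda>x. c * f x) \<in> V)"

text \<open>
  Only the inequality is demanded for scaling; applied to \<open>1 / c\<close> it yields the reverse one, and it is
  less to check for the infima formed below.
\<close>

definition sublinear_on :: "('a \<Rightarrow> real) set \<Rightarrow> (('a \<Rightarrow> real) \<Rightarrow> real) \<Rightarrow> bool" where
  "sublinear_on V p \<longleftrightarrow> (\<forall>f\<in>V. \<forall>g\<in>V. p (\<lambda>x. f x + g x) \<le> p f + p g) \<and>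
     (\<forall>f\<in>V. \<forall>c>0. p (\<lambda>x. c * f x) \<le> c * p f)"

definition linear_functional_on :: "('a \<Rightarrow> real) set \<Rightarrow> (('a \<Rightarrow> real) \<Rightarrow> real) \<Rightarrow> bool" where
  "linear_functional_on V \<phi> \<longleftrightarrow> (\<forall>f\<in>V. \<forall>g\<in>V. \<phi> (\<lambda>x. f x + g x) = \<phi> f + \<phi> g) \<and>
     (\<forall>f\<in>V. \<forall>c. \<phi> (\<lambda>x. c * f x) = c * \<phi> f)"

lemma linear_functional_on_minus:
  "linear_functional_on V \<phi> \<Longrightarrow> f \<in> V \<Longrightarrow> \<phi> (\<lambda>x. - f x) = - \<phi> f"
  by (auto simp: linear_functional_on_def dest!: bspec[where x = f] elim!: allE[where x = "- 1"])

text \<open>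
  A pair \<open>(f, c)\<close> stands for the condition \<open>\<phi> f \<le> c\<close> on an unknown linear functional \<open>\<phi>\<close>.
  The closure properties are those that such conditions inherit from the linearity of \<open>\<phi>\<close>.
\<close>

definition constraint_cone :: "('a \<Rightarrow> real) set \<Rightarrow> (('a \<Rightarrow> real) \<times> real) set \<Rightarrow> bool" where
  "constraint_cone V K \<longleftrightarrow> fst ` K \<subseteq> V \<and> ((\<lambda>_. 0), 0) \<in> K \<and>
     (\<forall>f c g d. (f, c) \<in> K \<longrightarrow> (g, d) \<in> K \<longrightarrow> ((\<lambda>x. f x + g x), c + d) \<in> K) \<and>
     (\<forall>f c s. (f, c) \<in> K \<longrightarrow> 0 < s \<longrightarrow> ((\<lambda>x. s * f x), s * c) \<in> K)"

lemma function_spaceD: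
  assumes "function_space V"
  shows "(\<lambda>_. 0) \<in> V" "f \<in> V \<Longrightarrow> g \<in> V \<Longrightarrow> (\<lambda>x. f x + g x) \<in> V"
    "f \<in> V \<Longrightarrow> (\<lambda>x. c * f x) \<in> V" "f \<in> V \<Longrightarrow> (\<lambda>x. - f x) \<in> V"
    "f \<in> V \<Longrightarrow> g \<in> V \<Longrightarrow> (\<lambda>x. f x - g x) \<in> V"
proof -
  show zero: "(\<lambda>_. 0) \<in> V" and add: "\<And>f g. f \<in> V \<Longrightarrow> g \<in> V \<Longrightarrow> (\<lambda>x. f x + g x) \<in> V"
    and scale: "\<And>f c. f \<in> V \<Longrightarrow> (\<lambda>x. c * f x) \<in> V"
    using assms by (auto simp: function_space_def)
  show neg: "\<And>f. f \<in> V \<Longrightarrow> (\<lambda>x. - f x) \<in> V" using scale[of _ "- 1"] by simp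
  show "f \<in> V \<Longrightarrow> g \<in> V \<Longrightarrow> (\<lambda>x. f x - g x) \<in> V" using add[OF _ neg] by simp
qed

lemma sublinear_onD:
  assumes "sublinear_on V p"
  shows "f \<in> V \<Longrightarrow> g \<in> V \<Longrightarrow> p (\<lambda>x. f x + g x) \<le> p f + p g"
    "f \<in> V \<Longrightarrow> 0 < c \<Longrightarrow> p (\<lambda>x. c * f x) \<le> c * p f"
  using assms by (auto simp: sublinear_on_def)

lemma sublinear_on_zero:
  assumes "function_space V" "sublinear_on V p"
  shows "p (\<lambda>_. 0) = 0"
  using sublinear_onD(1)[OF assms(2), of "\<lambda>_. 0" "\<lambda>_. 0"]
    sublinear_onD(2)[OF assms(2), of "\<lambda>_. 0" "1/2"] function_spaceD(1)[OF assms(1)] by simp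

lemma sublinear_on_scale:
  assumes V: "function_space V" and p: "sublinear_on V p" and f: "f \<in> V" and c: "0 \<le> c"
  shows "p (\<lambda>x. c * f x) = c * p f"
proof (cases "c = 0")
  case True
  then show ?thesis using sublinear_on_zero[OF V p] by simp
next
  case False
  then have c: "0 < c" using c by simp
  have "p (\<lambda>x. inverse c * (c * f x)) \<le> inverse c * p (\<lambda>x. c * f x)"
    using c by (intro sublinear_onD(2)[OF p] function_spaceD[OF V] f) auto
  moreover have "(\<lambda>x. inverse c * (c * f x)) = f" using c by auto
  ultimately have "c * p f \<le> p (\<lambda>x. c * f x)"
    using c by (simp add: field_simps)
  then show ?thesis using sublinear_onD(2)[OF p f c] by simp
qed

lemma sublinear_on_minus:
  assumes V: "function_space V" and p: "sublinear_on V p" and f: "f \<in> V"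
  shows "- p (\<lambda>x. - f x) \<le> p f"
  using sublinear_onD(1)[OF p f function_spaceD(4)[OF V f]] sublinear_on_zero[OF V p] by simp

text \<open>
  The functional is \<open>p f = INF (g, c) \<in> K. r (f - g) + c\<close>, the largest sublinear one that is compatible
  with both \<open>r\<close> and \<open>K\<close>. Consistency of each constraint with \<open>r\<close> bounds the infimum from below by
  \<open>- r (- f)\<close>; convexity of \<open>K\<close> gives subadditivity.
\<close>

lemma sublinear_on_inf_convolution:
  assumes V: "function_space V" and r: "sublinear_on V r" and K: "constraint_cone V K"
    and consistent: "\<And>f c. (f, c) \<in> K \<Longrightarrow> 0 \<le> r (\<lambda>x. - f x) + c"
  obtains p where "sublinear_on V p" "\<And>f. f \<in> V \<Longrightarrow> p f \<le> r f"
    "\<And>f c. (f, c) \<in> K \<Longrightarrow> p f \<le> c"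
proof
  note VD = function_spaceD[OF V] and rD = sublinear_onD[OF r]
  have KV: "f \<in> V" if "(f, c) \<in> K" for f c
    using K that by (force simp: constraint_cone_def)
  have K0: "((\<lambda>_. 0), 0) \<in> K"
    and Kadd: "\<And>f c g d. (f, c) \<in> K \<Longrightarrow> (g, d) \<in> K \<Longrightarrow> ((\<lambda>x. f x + g x), c + d) \<in> K"
    and Kscale: "\<And>f c s. (f, c) \<in> K \<Longrightarrow> 0 < s \<Longrightarrow> ((\<lambda>x. s * f x), s * c) \<in> K"
    using K unfolding constraint_cone_def by blast+
  \<comment> \<open>The infimum of \<open>h f\<close> over \<open>K\<close> is the infimal convolution.\<close>
  define h where "h f = (\<lambda>(g, c). r (\<lambda>x. f x - g x) + c)" for f
  define p where "p f = (INF k\<in>K. h f k)" for f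
  have lower: "- r (\<lambda>x. - f x) \<le> h f k" if f: "f \<in> V" and kK: "k \<in> K" for f k
  proof -
    obtain g c where k: "k = (g, c)" by (cases k)
    have g: "g \<in> V" using KV k kK by blast
    have "r (\<lambda>x. (f x - g x) + - f x) \<le> r (\<lambda>x. f x - g x) + r (\<lambda>x. - f x)"
      using f g by (intro rD VD)
    then show ?thesis using consistent kK by (auto simp: h_def k dest: consistent)
  qed
  have bdd: "bdd_below (h f ` K)" if "f \<in> V" for f
    using lower[OF that] by (auto intro!: bdd_belowI2)
  have p_le: "p f \<le> h f k" if "f \<in> V" "k \<in> K" for f k
    unfolding p_def using bdd that by (intro cINF_lower)
  have p_ge: "b \<le> p f" if "\<And>k. k \<in> K \<Longrightarrow> b \<le> h f k" for b f
    unfolding p_def using that K0 by (intro cINF_greatest) auto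
  show "sublinear_on V p"
    unfolding sublinear_on_def
  proof (intro conjI ballI allI impI)
    fix f g assume f: "f \<in> V" and g: "g \<in> V"
    have *: "p (\<lambda>x. f x + g x) \<le> h f k + h g l" if k: "k \<in> K" and l: "l \<in> K" for k l
    proof -
      obtain a c b d where kl: "k = (a, c)" "l = (b, d)" by (metis surj_pair)
      have ab: "a \<in> V" "b \<in> V" using kl k l KV by blast+
      have "p (\<lambda>x. f x + g x) \<le> h (\<lambda>x. f x + g x) ((\<lambda>x. a x + b x), c + d)"
        using k l kl by (intro p_le VD f g Kadd) auto
      also have "\<dots> = r (\<lambda>x. (f x - a x) + (g x - b x)) + (c + d)"
        by (simp add: h_def algebra_simps)
      also have "\<dots> \<le> h f k + h g l"
        using rD(1)[OF VD(5)[OF f ab(1)] VD(5)[OF g ab(2)]] by (simp add: h_def kl)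
      finally show ?thesis .
    qed
    have "p (\<lambda>x. f x + g x) - p f \<le> h g l" if l: "l \<in> K" for l
      using p_ge[of "p (\<lambda>x. f x + g x) - h g l" f] *[OF _ l] by (simp add: algebra_simps)
    then show "p (\<lambda>x. f x + g x) \<le> p f + p g"
      using p_ge[of "p (\<lambda>x. f x + g x) - p f" g] by simp
  next
    fix f and c :: real assume f: "f \<in> V" and c: "0 < c"
    have "p (\<lambda>x. c * f x) / c \<le> h f k" if k: "k \<in> K" for k
    proof -
      obtain a d where k': "k = (a, d)" by (cases k)
      have a: "a \<in> V" using k k' KV by blast
      have "p (\<lambda>x. c * f x) \<le> h (\<lambda>x. c * f x) ((\<lambda>x. c * a x), c * d)"
        using k k' c by (intro p_le VD f Kscale) auto
      also have "\<dots> = r (\<lambda>x. c * (f x - a x)) + c * d"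
        by (simp add: h_def algebra_simps)
      also have "\<dots> \<le> c * h f k"
        using rD(2)[OF VD(5)[OF f a] c] by (simp add: h_def k' algebra_simps)
      finally show ?thesis using c by (simp add: field_simps)
    qed
    then show "p (\<lambda>x. c * f x) \<le> c * p f"
      using p_ge[of "p (\<lambda>x. c * f x) / c" f] c by (simp add: field_simps)
  qed
  show "p f \<le> r f" if "f \<in> V" for f
    using p_le[OF that K0] by (simp add: h_def)
  show "p f \<le> c" if "(f, c) \<in> K" for f c
    using p_le[OF KV[OF that] that] sublinear_on_zero[OF V r] by (simp add: h_def)
qed

text \<open>
  Zorn's lemma applies to the pointwise order, because the infimum of a chain of sublinear
  functionals below \<open>p\<close> is again sublinear: it is bounded below by \<open>- p (- f)\<close>, and for two members of
  the chain the smaller one serves both summands in the subadditivity estimate.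
\<close>

lemma minimal_sublinear_exists:
  assumes V: "function_space V" and p: "sublinear_on V p"
  obtains q where "sublinear_on V q" "\<And>f. f \<in> V \<Longrightarrow> q f \<le> p f"
    "\<And>q' f. sublinear_on V q' \<Longrightarrow> (\<And>g. g \<in> V \<Longrightarrow> q' g \<le> q g) \<Longrightarrow> f \<in> V \<Longrightarrow> q' f = q f"
proof -
  note VD = function_spaceD[OF V]
  \<comment> \<open>Fixing the value \<open>0\<close> outside \<open>V\<close> makes the pointwise order antisymmetric.\<close>
  define S where "S = {q. sublinear_on V q \<and> (\<forall>f\<in>V. q f \<le> p f) \<and> (\<forall>f. f \<notin> V \<longrightarrow> q f = 0)}"
  have cong: "sublinear_on V (\<lambda>f. if f \<in> V then q f else 0)" if "sublinear_on V q" for q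
    using that VD unfolding sublinear_on_def by simp
  have "\<exists>q\<in>S. \<forall>q'\<in>S. q' \<le> q \<longrightarrow> q' = q"
  proof (rule predicate_Zorn)
    show "partial_order_on S (relation_of (\<lambda>q q'. q' \<le> q) S)"
      by (rule partial_order_on_relation_ofI) auto
    fix C assume C: "C \<in> Chains (relation_of (\<lambda>q q'. q' \<le> q) S)"
    have CS: "C \<subseteq> S" using C by (auto simp: Chains_def relation_of_def)
    have total: "q \<le> q' \<or> q' \<le> q" if "q \<in> C" "q' \<in> C" for q q'
      using C that by (auto simp: Chains_def relation_of_def)
    show "\<exists>u\<in>S. \<forall>a\<in>C. u \<le> a"
    proof (cases "C = {}")
      case True
      have "(\<lambda>f. if f \<in> V then p f else 0) \<in> S" using cong[OF p] by (simp add: S_def)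
      then show ?thesis using True by blast
    next
      case False
      define u where "u f = (INF q\<in>C. q f)" for f
      have lower: "- p (\<lambda>x. - f x) \<le> q f" if "q \<in> C" "f \<in> V" for q f
      proof -
        have q: "sublinear_on V q" "q (\<lambda>x. - f x) \<le> p (\<lambda>x. - f x)"
          using that CS VD(4) by (auto simp: S_def)
        then show ?thesis using sublinear_on_minus[OF V q(1) that(2)] by linarith
      qed
      have u_le: "u f \<le> q f" if "q \<in> C" "f \<in> V" for q f
        unfolding u_def using lower that by (intro cINF_lower bdd_belowI2) auto
      have u_ge: "b \<le> u f" if "\<And>q. q \<in> C \<Longrightarrow> b \<le> q f" for b f
        unfolding u_def using that False by (intro cINF_greatest) auto
      have "sublinear_on V u"
        unfolding sublinear_on_def
      proof (intro conjI ballI allI impI)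
        fix f g assume f: "f \<in> V" and g: "g \<in> V"
        have *: "u (\<lambda>x. f x + g x) \<le> q f + q' g" if qq: "q \<in> C" "q' \<in> C" for q q'
        proof -
          obtain m where m: "m \<in> C" "m f \<le> q f" "m g \<le> q' g"
            using total[OF qq] qq by (auto simp: le_fun_def)
          have "u (\<lambda>x. f x + g x) \<le> m (\<lambda>x. f x + g x)" by (intro u_le m VD f g)
          also have "\<dots> \<le> m f + m g" using m CS f g by (auto simp: S_def sublinear_on_def)
          finally show ?thesis using m by simp
        qed
        have "u (\<lambda>x. f x + g x) - u f \<le> q' g" if l: "q' \<in> C" for q'
          using u_ge[of "u (\<lambda>x. f x + g x) - q' g" f] *[OF _ l] by (simp add: algebra_simps)
        then show "u (\<lambda>x. f x + g x) \<le> u f + u g"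
          using u_ge[of "u (\<lambda>x. f x + g x) - u f" g] by simp
      next
        fix f and c :: real assume f: "f \<in> V" and c: "0 < c"
        have "u (\<lambda>x. c * f x) / c \<le> q f" if q: "q \<in> C" for q
        proof -
          have "u (\<lambda>x. c * f x) \<le> q (\<lambda>x. c * f x)" by (intro u_le q VD f)
          also have "\<dots> \<le> c * q f" using q CS f c by (auto simp: S_def sublinear_on_def)
          finally show ?thesis using c by (simp add: field_simps)
        qed
        then show "u (\<lambda>x. c * f x) \<le> c * u f"
          using u_ge[of "u (\<lambda>x. c * f x) / c" f] c by (simp add: field_simps)
      qed
      moreover have "u f \<le> p f" if "f \<in> V" for f
      proof -
        obtain q where q: "q \<in> C" using False by blast
        then have "q f \<le> p f" using CS that by (auto simp: S_def)
        then show ?thesis using u_le[OF q that] by simp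
      qed
      ultimately have "(\<lambda>f. if f \<in> V then u f else 0) \<in> S" using cong by (simp add: S_def)
      moreover have "(\<lambda>f. if f \<in> V then u f else 0) \<le> q" if "q \<in> C" for q
        using that CS u_le by (auto simp: le_fun_def S_def)
      ultimately show ?thesis by blast
    qed
  qed
  then obtain q where q: "q \<in> S" and min: "\<And>q'. q' \<in> S \<Longrightarrow> q' \<le> q \<Longrightarrow> q' = q" by blast
  show ?thesis
  proof
    show "sublinear_on V q" "\<And>f. f \<in> V \<Longrightarrow> q f \<le> p f" using q by (auto simp: S_def)
    fix q' f assume q': "sublinear_on V q'" "\<And>g. g \<in> V \<Longrightarrow> q' g \<le> q g" and f: "f \<in> V"
    have "(\<lambda>f. if f \<in> V then q' f else 0) = q"
    proof (rule min)
      show "(\<lambda>f. if f \<in> V then q' f else 0) \<in> S"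
        using cong[OF q'(1)] q q'(2) by (fastforce simp: S_def)
      show "(\<lambda>f. if f \<in> V then q' f else 0) \<le> q"
        using q q'(2) by (auto simp: le_fun_def S_def)
    qed
    then show "q' f = q f" using f by (auto dest: fun_cong[where x = f])
  qed
qed

text \<open>
  If \<open>q (- f) > - q f\<close> for some \<open>f\<close>, then imposing the constraint \<open>\<phi> (- f) \<le> - q f\<close> by infimal
  convolution would produce a strictly smaller sublinear functional. So \<open>q\<close> is odd, and an odd
  sublinear functional is linear.
\<close>

lemma minimal_sublinear_is_linear:
  assumes V: "function_space V" and q: "sublinear_on V q"
    and minimal: "\<And>q' f. sublinear_on V q' \<Longrightarrow> (\<And>g. g \<in> V \<Longrightarrow> q' g \<le> q g) \<Longrightarrow> f \<in> V \<Longrightarrow> q' f = q f"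
  shows "linear_functional_on V q"
proof -
  note VD = function_spaceD[OF V]
  have neg: "q (\<lambda>x. - f x) = - q f" if f: "f \<in> V" for f
  proof -
    \<comment> \<open>The cone generated by the single constraint \<open>\<phi> (- f) \<le> - q f\<close>.\<close>
    define K where "K = {((\<lambda>x. - (t * f x)), - (t * q f)) | t. 0 \<le> t}"
    have K: "constraint_cone V K"
      unfolding constraint_cone_def
    proof (intro conjI allI impI)
      show "fst ` K \<subseteq> V" using VD(4)[OF VD(3)[OF f]] by (auto simp: K_def)
      show "((\<lambda>_. 0), 0) \<in> K" by (auto simp: K_def intro!: exI[of _ 0])
      fix g c h d assume "(g, c) \<in> K" "(h, d) \<in> K"
      then obtain s t where "0 \<le> s" "0 \<le> t" "g = (\<lambda>x. - (s * f x))" "c = - (s * q f)"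
        "h = (\<lambda>x. - (t * f x))" "d = - (t * q f)"
        by (auto simp: K_def)
      then show "((\<lambda>x. g x + h x), c + d) \<in> K"
        unfolding K_def by (intro CollectI exI[of _ "s + t"]) (auto simp: algebra_simps)
    next
      fix g c and s :: real assume "(g, c) \<in> K" "0 < s"
      then obtain t where "0 \<le> t" "g = (\<lambda>x. - (t * f x))" "c = - (t * q f)" "0 < s"
        by (auto simp: K_def)
      then show "((\<lambda>x. s * g x), s * c) \<in> K"
        unfolding K_def by (intro CollectI exI[of _ "s * t"]) (auto simp: algebra_simps)
    qed
    have consistent: "0 \<le> q (\<lambda>x. - g x) + c" if "(g, c) \<in> K" for g c
      using that sublinear_on_scale[OF V q f] by (auto simp: K_def)
    obtain p where p: "sublinear_on V p" "\<And>f. f \<in> V \<Longrightarrow> p f \<le> q f"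
      "\<And>f c. (f, c) \<in> K \<Longrightarrow> p f \<le> c"
      using sublinear_on_inf_convolution[OF V q K consistent] by blast
    have "((\<lambda>x. - f x), - q f) \<in> K" unfolding K_def by (auto intro!: exI[of _ 1])
    then have "p (\<lambda>x. - f x) \<le> - q f" by (rule p(3))
    then have "q (\<lambda>x. - f x) \<le> - q f"
      using minimal[OF p(1,2) VD(4)[OF f]] by simp
    then show ?thesis using sublinear_on_minus[OF V q f] by simp
  qed
  show ?thesis
    unfolding linear_functional_on_def
  proof (intro conjI ballI allI)
    fix f g assume f: "f \<in> V" and g: "g \<in> V"
    have "q (\<lambda>x. (f x + g x) + - g x) \<le> q (\<lambda>x. f x + g x) + q (\<lambda>x. - g x)"
      by (intro sublinear_onD[OF q] VD f g)
    then show "q (\<lambda>x. f x + g x) = q f + q g"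
      using sublinear_onD(1)[OF q f g] neg[OF g] by simp
  next
    fix f and c :: real assume f: "f \<in> V"
    show "q (\<lambda>x. c * f x) = c * q f"
    proof (cases "0 \<le> c")
      case True
      then show ?thesis by (rule sublinear_on_scale[OF V q f])
    next
      case False
      then show ?thesis
        using sublinear_on_scale[OF V q f, of "- c"] neg[OF VD(3)[OF f, of c]] by simp
    qed
  qed
qed

text \<open>
  First the constraints are absorbed into the dominating functional by infimal convolution, then a
  minimal sublinear functional below the result is taken.
\<close>

theorem Hahn_Banach_constrained:
  assumes V: "function_space V" and r: "sublinear_on V r" and K: "constraint_cone V K"
    and consistent: "\<And>f c. (f, c) \<in> K \<Longrightarrow> 0 \<le> r (\<lambda>x. - f x) + c"
  obtains \<phi> where "linear_functional_on V \<phi>" "\<And>f. f \<in> V \<Longrightarrow> \<phi> f \<le> r f"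
    "\<And>f c. (f, c) \<in> K \<Longrightarrow> \<phi> f \<le> c"
proof -
  obtain p where p: "sublinear_on V p" "\<And>f. f \<in> V \<Longrightarrow> p f \<le> r f"
    "\<And>f c. (f, c) \<in> K \<Longrightarrow> p f \<le> c"
    using sublinear_on_inf_convolution[OF V r K consistent] by blast
  obtain q where q: "sublinear_on V q" "\<And>f. f \<in> V \<Longrightarrow> q f \<le> p f"
    and min: "\<And>q' f. sublinear_on V q' \<Longrightarrow> (\<And>g. g \<in> V \<Longrightarrow> q' g \<le> q g) \<Longrightarrow> f \<in> V \<Longrightarrow> q' f = q f"
    using minimal_sublinear_exists[OF V p(1)] by blast
  have KV: "f \<in> V" if "(f, c) \<in> K" for f c
    using K that by (force simp: constraint_cone_def)
  show ?thesis
  proof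
    show "linear_functional_on V q" using V q(1) min by (rule minimal_sublinear_is_linear)
    show "\<And>f. f \<in> V \<Longrightarrow> q f \<le> r f" using p(2) q(2) order_trans by blast
    show "\<And>f c. (f, c) \<in> K \<Longrightarrow> q f \<le> c" using p(3) q(2) KV order_trans by blast
  qed
qed

section \<open>Positive functionals and finitely additive probabilities\<close>

definition bounded_measurable :: "'a measure \<Rightarrow> ('a \<Rightarrow> real) set" where
  "bounded_measurable M = {f \<in> borel_measurable M. bounded (f ` space M)}"

lemma bounded_measurable_iff:
  "f \<in> bounded_measurable M \<longleftrightarrow> f \<in> borel_measurable M \<and> (\<exists>c. \<forall>x\<in>space M. \<bar>f x\<bar> \<le> c)"
  by (auto simp: bounded_measurable_def bounded_iff)

lemma bounded_measurableI:
  "f \<in> borel_measurable M \<Longrightarrow> (\<And>x. x \<in> space M \<Longrightarrow> \<bar>f x\<bar> \<le> c) \<Longrightarrow> f \<in> bounded_measurable M"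
  by (auto simp: bounded_measurable_iff)

lemma bounded_measurable_const [simp]: "(\<lambda>_. c) \<in> bounded_measurable M"
  by (auto simp: bounded_measurable_iff)

lemma bounded_measurable_indicator: "A \<in> sets M \<Longrightarrow> indicator A \<in> bounded_measurable M"
  by (rule bounded_measurableI[where c = 1]) (auto simp: indicator_def)

lemma simple_function_bounded_measurable:
  fixes s :: "'a \<Rightarrow> real"
  shows "simple_function M s \<Longrightarrow> s \<in> bounded_measurable M"
  by (simp add: bounded_measurable_def borel_measurable_simple_function finite_imp_bounded
      simple_functionD(1))

lemma function_space_bounded_measurable: "function_space (bounded_measurable M)"
  unfolding function_space_def
proof (intro conjI ballI allI)
  fix f g :: "'a \<Rightarrow> real" assume "f \<in> bounded_measurable M" "g \<in> bounded_measurable M"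
  then obtain a b where *: "f \<in> borel_measurable M" "g \<in> borel_measurable M"
    "\<forall>x\<in>space M. \<bar>f x\<bar> \<le> a" "\<forall>x\<in>space M. \<bar>g x\<bar> \<le> b"
    by (auto simp: bounded_measurable_iff)
  have "\<forall>x\<in>space M. \<bar>f x + g x\<bar> \<le> a + b"
    using * by (meson abs_triangle_ineq add_mono order_trans)
  then show "(\<lambda>x. f x + g x) \<in> bounded_measurable M"
    using * by (auto intro: bounded_measurableI)
next
  fix f :: "'a \<Rightarrow> real" and c :: real assume "f \<in> bounded_measurable M"
  then obtain a where *: "f \<in> borel_measurable M" "\<forall>x\<in>space M. \<bar>f x\<bar> \<le> a"
    by (auto simp: bounded_measurable_iff)
  then have "\<forall>x\<in>space M. \<bar>c * f x\<bar> \<le> \<bar>c\<bar> * a"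
    by (simp add: abs_mult mult_left_mono)
  then show "(\<lambda>x. c * f x) \<in> bounded_measurable M"
    using * by (auto intro: bounded_measurableI)
qed simp

lemmas bounded_measurable_closed = function_spaceD[OF function_space_bounded_measurable]

lemma (in finite_measure) integrable_bounded_measurable:
  "f \<in> bounded_measurable M \<Longrightarrow> integrable M f"
  unfolding bounded_measurable_iff
  by (auto intro!: integrable_const_bound AE_I2)

text \<open>
  On a common partition the inequality can fail only on cells that are null for \<open>M\<close>, hence also for
  \<open>P\<close>; the other cells are compared term by term.
\<close>

lemma fa_simple_integral_mono_AE:
  assumes P: "fa_prob M P" and ac: "fa_abs_cont M P (measure M)"
    and s: "simple_function M s" and t: "simple_function M t"
    and le: "AE \<omega> in M. s \<omega> \<le> t \<omega> + e"
  shows "fa_simple_integral M P s \<le> fa_simple_integral M P t + e"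
proof -
  let ?g = "\<lambda>\<omega>. (s \<omega>, t \<omega>)"
  let ?G = "\<lambda>z. {\<omega>\<in>space M. ?g \<omega> = z}"
  have g: "simple_function M ?g" using s t by (rule simple_function_Pair)
  have fin: "finite (?g ` space M)" using g by (rule simple_functionD)
  have G: "?G z \<in> sets M" for z
  proof -
    have "?G z = ?g -` {z} \<inter> space M" by auto
    then show ?thesis using simple_functionD(2)[OF g] by metis
  qed
  have tot: "(\<Sum>z\<in>?g ` space M. P (?G z)) = 1"
  proof -
    have "(\<Union>z\<in>?g ` space M. ?G z) = space M" by auto
    moreover have "P (\<Union>z\<in>?g ` space M. ?G z) = (\<Sum>z\<in>?g ` space M. P (?G z))"
      by (rule fa_prob_sum_UN[OF P fin G]) (auto simp: disjoint_family_on_def)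
    ultimately have "P (space M) = (\<Sum>z\<in>?g ` space M. P (?G z))" by simp
    then show ?thesis using P by (simp add: fa_prob_def)
  qed
  have "fa_simple_integral M P s = (\<Sum>z\<in>?g ` space M. fst z * P (?G z))"
    by (rule fa_simple_integral_partition[OF P g]) simp
  also have "\<dots> \<le> (\<Sum>z\<in>?g ` space M. (snd z + e) * P (?G z))"
  proof (rule sum_mono)
    fix z
    show "fst z * P (?G z) \<le> (snd z + e) * P (?G z)"
    proof (cases "fst z \<le> snd z + e")
      case True
      moreover have "0 \<le> P (?G z)" using P G by (auto simp: fa_prob_def)
      ultimately show ?thesis by (rule mult_right_mono)
    next
      case False
      have "AE \<omega> in M. \<omega> \<notin> ?G z" using le by eventually_elim (use False in auto)
      then have "measure M (?G z) = 0" using G by (simp add: measure_eq_0_null_sets AE_iff_null_sets)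
      then have "P (?G z) = 0" using ac G by (auto simp: fa_abs_cont_def)
      then show ?thesis by simp
    qed
  qed
  also have "\<dots> = (\<Sum>z\<in>?g ` space M. snd z * P (?G z)) + e * (\<Sum>z\<in>?g ` space M. P (?G z))"
    by (simp add: distrib_right sum.distrib sum_distrib_left)
  also have "(\<Sum>z\<in>?g ` space M. snd z * P (?G z)) = fa_simple_integral M P t"
    by (rule fa_simple_integral_partition[OF P g, symmetric]) simp
  finally show ?thesis using tot by simp
qed

lemma fa_integral_mono_AE:
  assumes P: "fa_prob M P" and ac: "fa_abs_cont M P (measure M)"
    and f: "f \<in> bounded_measurable M" and g: "g \<in> bounded_measurable M"
    and le: "AE \<omega> in M. f \<omega> \<le> g \<omega> + e"
  shows "fa_integral M P f \<le> fa_integral M P g + e"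
proof -
  obtain s where s: "\<And>n. simple_function M (s n)" "uniform_limit (space M) s f sequentially"
    "(\<lambda>n. fa_simple_integral M P (s n)) \<longlonglongrightarrow> fa_integral M P f"
    using has_fa_integral_fa_integral[OF P, of f] f
    unfolding has_fa_integral_def bounded_measurable_def by auto
  obtain t where t: "\<And>n. simple_function M (t n)" "uniform_limit (space M) t g sequentially"
    "(\<lambda>n. fa_simple_integral M P (t n)) \<longlonglongrightarrow> fa_integral M P g"
    using has_fa_integral_fa_integral[OF P, of g] g
    unfolding has_fa_integral_def bounded_measurable_def by auto
  have "fa_integral M P f \<le> fa_integral M P g + (e + 2 * d)" if d: "0 < d" for d
  proof (rule tendsto_le[OF sequentially_bot])
    show "(\<lambda>n. fa_simple_integral M P (t n) + (e + 2 * d)) \<longlonglongrightarrow> fa_integral M P g + (e + 2 * d)"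
      by (intro tendsto_intros t)
    show "(\<lambda>n. fa_simple_integral M P (s n)) \<longlonglongrightarrow> fa_integral M P f" by fact
    have "\<forall>\<^sub>F n in sequentially. \<forall>\<omega>\<in>space M. dist (s n \<omega>) (f \<omega>) < d"
      "\<forall>\<^sub>F n in sequentially. \<forall>\<omega>\<in>space M. dist (t n \<omega>) (g \<omega>) < d"
      using s(2) t(2) d unfolding uniform_limit_iff by blast+
    then show "\<forall>\<^sub>F n in sequentially.
        fa_simple_integral M P (s n) \<le> fa_simple_integral M P (t n) + (e + 2 * d)"
    proof eventually_elim
      case (elim n)
      have "AE \<omega> in M. s n \<omega> \<le> t n \<omega> + (e + 2 * d)"
        using le AE_space
      proof eventually_elim
        case (elim \<omega>)
        then have "\<bar>s n \<omega> - f \<omega>\<bar> < d" "\<bar>t n \<omega> - g \<omega>\<bar> < d"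
          using \<open>\<forall>\<omega>\<in>space M. dist (s n \<omega>) (f \<omega>) < d\<close> \<open>\<forall>\<omega>\<in>space M. dist (t n \<omega>) (g \<omega>) < d\<close>
          by (auto simp: dist_real_def)
        then show ?case using elim by linarith
      qed
      then show ?case by (rule fa_simple_integral_mono_AE[OF P ac s(1) t(1)])
    qed
  qed
  then have "fa_integral M P f \<le> fa_integral M P g + (e + 2 * (d / 2))" if "0 < d" for d
    using that half_gt_zero by blast
  then have "fa_integral M P f \<le> (fa_integral M P g + e) + d" if "0 < d" for d
    using that by fastforce
  then show ?thesis by (rule field_le_epsilon)
qed

definition positive_functional :: "'a measure \<Rightarrow> (('a \<Rightarrow> real) \<Rightarrow> real) \<Rightarrow> bool" where
  "positive_functional M \<phi> \<longleftrightarrow> linear_functional_on (bounded_measurable M) \<phi> \<and>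
     (\<forall>f\<in>bounded_measurable M. (\<forall>x\<in>space M. 0 \<le> f x) \<longrightarrow> 0 \<le> \<phi> f)"

lemma positive_functionalD:
  assumes "positive_functional M \<phi>"
  shows "f \<in> bounded_measurable M \<Longrightarrow> g \<in> bounded_measurable M \<Longrightarrow>
      \<phi> (\<lambda>x. f x + g x) = \<phi> f + \<phi> g"
    and "f \<in> bounded_measurable M \<Longrightarrow> \<phi> (\<lambda>x. c * f x) = c * \<phi> f"
    and "f \<in> bounded_measurable M \<Longrightarrow> (\<And>x. x \<in> space M \<Longrightarrow> 0 \<le> f x) \<Longrightarrow> 0 \<le> \<phi> f"
  using assms by (auto simp: positive_functional_def linear_functional_on_def)

lemma positive_functional_mono:
  assumes \<phi>: "positive_functional M \<phi>"
    and f: "f \<in> bounded_measurable M" and g: "g \<in> bounded_measurable M"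
    and le: "\<And>x. x \<in> space M \<Longrightarrow> f x \<le> g x"
  shows "\<phi> f \<le> \<phi> g"
proof -
  note D = positive_functionalD[OF \<phi>] and C = bounded_measurable_closed
  have "0 \<le> \<phi> (\<lambda>x. g x + - 1 * f x)" using f g le by (intro D C) auto
  also have "\<dots> = \<phi> g + - 1 * \<phi> f" using f g by (simp only: D C)
  finally show ?thesis by simp
qed

lemma positive_functional_sum:
  assumes \<phi>: "positive_functional M \<phi>" and I: "finite I"
    and f: "\<And>i. i \<in> I \<Longrightarrow> f i \<in> bounded_measurable M"
  shows "(\<lambda>x. \<Sum>i\<in>I. f i x) \<in> bounded_measurable M \<and> \<phi> (\<lambda>x. \<Sum>i\<in>I. f i x) = (\<Sum>i\<in>I. \<phi> (f i))"
  using I f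
proof (induction I)
  case empty
  then show ?case using positive_functionalD(2)[OF \<phi>, of "\<lambda>_. 0" 0] by simp
next
  case (insert i I)
  then show ?case
    using positive_functionalD(1)[OF \<phi>, of "f i" "\<lambda>x. \<Sum>i\<in>I. f i x"]
      bounded_measurable_closed(2)[of "f i" M "\<lambda>x. \<Sum>i\<in>I. f i x"] by simp
qed

text \<open>
  A simple function is a finite linear combination of the indicators of its level sets.
\<close>

lemma positive_functional_simple:
  assumes \<phi>: "positive_functional M \<phi>" and P: "\<And>A. A \<in> sets M \<Longrightarrow> P A = \<phi> (indicator A)"
    and s: "simple_function M s"
  shows "\<phi> s = fa_simple_integral M P s"
proof -
  let ?G = "\<lambda>y. {\<omega>\<in>space M. s \<omega> = y}"
  have fin: "finite (s ` space M)" using s by (rule simple_functionD)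
  have G: "?G y \<in> sets M" for y
  proof -
    have "?G y = s -` {y} \<inter> space M" by auto
    then show ?thesis using simple_functionD(2)[OF s] by metis
  qed
  have ind: "(\<lambda>\<omega>. y * indicator (?G y) \<omega>) \<in> bounded_measurable M" for y
    using G by (intro bounded_measurable_closed bounded_measurable_indicator)
  note sum = positive_functional_sum[OF \<phi> fin ind]
  have eq: "s \<omega> = (\<Sum>y\<in>s ` space M. y * indicator (?G y) \<omega>)" if "\<omega> \<in> space M" for \<omega>
  proof -
    have "(\<Sum>y\<in>s ` space M. y * indicator (?G y) \<omega>) = (\<Sum>y\<in>s ` space M. if y = s \<omega> then y else 0)"
      using that by (intro sum.cong) (auto simp: indicator_def)
    then show ?thesis using fin that by simp
  qed
  have "\<phi> s = \<phi> (\<lambda>\<omega>. \<Sum>y\<in>s ` space M. y * indicator (?G y) \<omega>)"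
    using sum simple_function_bounded_measurable[OF s]
    by (intro antisym positive_functional_mono[OF \<phi>]) (simp_all flip: eq)
  also have "\<dots> = (\<Sum>y\<in>s ` space M. y * P (?G y))"
    using sum G by (simp add: P positive_functionalD(2)[OF \<phi> bounded_measurable_indicator])
  finally show ?thesis by (simp add: fa_simple_integral_def)
qed

text \<open>
  Positivity makes the functional continuous for the supremum norm, with constant \<open>\<phi> 1\<close>.
\<close>

lemma positive_functional_uniform_limit:
  assumes \<phi>: "positive_functional M \<phi>" and s: "\<And>n. s n \<in> bounded_measurable M"
    and f: "f \<in> bounded_measurable M" and lim: "uniform_limit (space M) s f sequentially"
  shows "(\<lambda>n. \<phi> (s n)) \<longlonglongrightarrow> \<phi> f"
proof (rule tendstoI)
  fix e :: real assume e: "0 < e"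
  define c where "c = \<phi> (\<lambda>_. 1)"
  have c: "0 \<le> c" unfolding c_def by (rule positive_functionalD[OF \<phi>]) auto
  \<comment> \<open>The summand \<open>1\<close> keeps the denominator positive when \<open>\<phi>\<close> is zero.\<close>
  define d where "d = e / (c + 1)"
  have d: "0 < d" and dc: "d * c < e"
    using c e by (auto simp: d_def field_simps)
  have shift: "\<phi> g \<le> \<phi> h + d * c" if "g \<in> bounded_measurable M" "h \<in> bounded_measurable M"
    "\<And>x. x \<in> space M \<Longrightarrow> g x \<le> h x + d * 1" for g h
  proof -
    have "\<phi> g \<le> \<phi> (\<lambda>x. h x + d * 1)"
      using that by (intro positive_functional_mono[OF \<phi>] bounded_measurable_closed) auto
    also have "\<dots> = \<phi> h + d * c"
      unfolding c_def using that(2) bounded_measurable_const[of 1 M]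
      by (simp only: positive_functionalD[OF \<phi>] bounded_measurable_closed)
    finally show ?thesis .
  qed
  have "\<forall>\<^sub>F n in sequentially. \<forall>\<omega>\<in>space M. dist (s n \<omega>) (f \<omega>) < d"
    using lim d unfolding uniform_limit_iff by blast
  then show "\<forall>\<^sub>F n in sequentially. dist (\<phi> (s n)) (\<phi> f) < e"
  proof eventually_elim
    case (elim n)
    have "\<phi> (s n) \<le> \<phi> f + d * c" "\<phi> f \<le> \<phi> (s n) + d * c"
      using elim by (force intro!: shift s f simp: dist_real_def abs_less_iff)+
    then show ?case using dc by (simp add: dist_real_def abs_less_iff)
  qed
qed

lemma positive_functional_has_fa_integral:
  assumes M: "prob_space M" and \<phi>: "positive_functional M \<phi>"
    and P: "\<And>A. A \<in> sets M \<Longrightarrow> P A = \<phi> (indicator A)" and f: "f \<in> bounded_measurable M"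
  shows "has_fa_integral M P f (\<phi> f)"
proof -
  obtain s where s: "\<And>n. simple_function M (s n)" "uniform_limit (space M) s f sequentially"
    using has_fa_integral_exists[OF fa_prob_measure[OF M refl], of f] f
    unfolding has_fa_integral_def bounded_measurable_def by blast
  have "(\<lambda>n. \<phi> (s n)) \<longlonglongrightarrow> \<phi> f"
    by (rule positive_functional_uniform_limit[OF \<phi> simple_function_bounded_measurable[OF s(1)] f s(2)])
  then show ?thesis
    using s positive_functional_simple[OF \<phi> P] unfolding has_fa_integral_def by auto
qed

text \<open>
  Bounded measurable functions are uniform limits of simple ones.
\<close>

lemma positive_functional_eqI:
  assumes M: "prob_space M" and \<phi>: "positive_functional M \<phi>" and \<psi>: "positive_functional M \<psi>"
    and eq: "\<And>A. A \<in> sets M \<Longrightarrow> \<phi> (indicator A) = \<psi> (indicator A)" and f: "f \<in> bounded_measurable M"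
  shows "\<phi> f = \<psi> f"
proof -
  obtain s where s: "\<And>n. simple_function M (s n)" "uniform_limit (space M) s f sequentially"
    using has_fa_integral_exists[OF fa_prob_measure[OF M refl], of f] f
    unfolding has_fa_integral_def bounded_measurable_def by blast
  have "(\<lambda>n. \<phi> (s n)) \<longlonglongrightarrow> \<phi> f" "(\<lambda>n. \<psi> (s n)) \<longlonglongrightarrow> \<psi> f"
    by (rule positive_functional_uniform_limit[OF _ simple_function_bounded_measurable[OF s(1)] f s(2)],
        fact)+
  moreover have "\<phi> (s n) = \<psi> (s n)" for n
    using positive_functional_simple[OF \<phi> eq[symmetric] s(1)] positive_functional_simple[OF \<psi> refl s(1)] by simp
  ultimately show ?thesis using LIMSEQ_unique by simp
qed

lemma indicator_union_disjoint:
  "A \<inter> B = {} \<Longrightarrow> (indicator (A \<union> B) :: 'a \<Rightarrow> real) = (\<lambda>x. indicator A x + indicator B x)"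
  by (auto simp: indicator_def fun_eq_iff)

lemma positive_functional_fa_prob:
  assumes \<phi>: "positive_functional M \<phi>" and one: "\<phi> (\<lambda>_. 1) = 1"
    and P: "\<And>A. A \<in> sets M \<Longrightarrow> P A = \<phi> (indicator A)"
  shows "fa_prob M P"
proof -
  have "\<phi> (indicator (space M)) = \<phi> (\<lambda>_. 1)"
    by (intro antisym positive_functional_mono[OF \<phi>] bounded_measurable_indicator) auto
  moreover have "additive (sets M) P"
    unfolding additive_def
    by (simp add: P indicator_union_disjoint positive_functionalD(1)[OF \<phi>]
        bounded_measurable_indicator)
  ultimately show ?thesis
    using one
    by (auto simp: fa_prob_def P intro!: positive_functionalD(3)[OF \<phi>] bounded_measurable_indicator)
qed

lemma positive_functional_integral:
  assumes "finite_measure Q" "sets Q = sets M"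
  shows "positive_functional M (\<lambda>f. \<integral>\<omega>. f \<omega> \<partial>Q)"
proof -
  interpret finite_measure Q by fact
  have sp: "space Q = space M" using assms(2) by (rule sets_eq_imp_space_eq)
  have "bounded_measurable M = bounded_measurable Q"
    by (simp add: bounded_measurable_def sp measurable_cong_sets[OF assms(2) refl])
  then have "integrable Q f" if "f \<in> bounded_measurable M" for f
    using that by (simp add: integrable_bounded_measurable)
  then show ?thesis
    unfolding positive_functional_def linear_functional_on_def
    by (auto intro!: Bochner_Integration.integral_nonneg simp: sp)
qed

section \<open>Convex cones of random variables and the closure condition\<close>

lemma rv_convex_cone_combination:
  assumes L: "rv_convex_cone L" and "X \<in> L" "Y \<in> L" "0 \<le> a" "0 \<le> b"
  shows "(\<lambda>\<omega>. a * X \<omega> + b * Y \<omega>) \<in> L"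
proof -
  have "(\<lambda>\<omega>. \<Sum>j=1..2::nat. (if j = 1 then a else b) * (if j = 1 then X else Y) \<omega>) \<in> L"
    using L[unfolded rv_convex_cone_def, rule_format, of 2 "\<lambda>j. if j = 1 then a else b"
        "\<lambda>j. if j = 1 then X else Y"] assms(2-) by auto
  then show ?thesis by (simp add: numeral_2_eq_2)
qed

lemma rv_convex_coneD:
  assumes L: "rv_convex_cone L"
  shows "X \<in> L \<Longrightarrow> Y \<in> L \<Longrightarrow> (\<lambda>\<omega>. X \<omega> + Y \<omega>) \<in> L"
    and "X \<in> L \<Longrightarrow> 0 \<le> a \<Longrightarrow> (\<lambda>\<omega>. a * X \<omega>) \<in> L"
    and "L \<noteq> {} \<Longrightarrow> (\<lambda>_. 0) \<in> L"
  using rv_convex_cone_combination[OF L, of X Y 1 1] rv_convex_cone_combination[OF L, of X X a 0]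
    rv_convex_cone_combination[OF L, of _ _ 0 0] by auto

lemma Linfty_norm_less_imp_AE:
  assumes "Linfty_norm M f < ereal e"
  shows "AE \<omega> in M. \<bar>f \<omega>\<bar> \<le> e"
  using esssup_AE[of "\<lambda>\<omega>. ereal \<bar>f \<omega>\<bar>" M]
proof eventually_elim
  case (elim \<omega>)
  then have "ereal \<bar>f \<omega>\<bar> < ereal e" using assms unfolding Linfty_norm_def by (rule le_less_trans)
  then show ?case by simp
qed

lemma Linfty_norm_leI:
  assumes "f \<in> borel_measurable M" "AE \<omega> in M. \<bar>f \<omega>\<bar> \<le> c"
  shows "Linfty_norm M f \<le> ereal c"
  unfolding Linfty_norm_def using assms by (intro esssup_I) auto

lemma bounded_measurable_Linfty:
  assumes "f \<in> bounded_measurable M"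
  shows "f \<in> Linfty M"
proof -
  obtain c where c: "f \<in> borel_measurable M" "\<forall>x\<in>space M. \<bar>f x\<bar> \<le> c"
    using assms by (auto simp: bounded_measurable_iff)
  then have "Linfty_norm M f \<le> ereal c" by (intro Linfty_norm_leI AE_I2) auto
  then show ?thesis using c(1) by (auto simp: Linfty_def)
qed

text \<open>
  Let \<open>f \<ge> 0\<close> be in the closure and let \<open>A\<close> be the event \<open>f \<ge> c\<close>. For each \<open>e > 0\<close> some \<open>X \<in> L\<close> satisfies
  \<open>c 1\<^sub>A \<le> f \<le> X + e\<close> almost surely, so \<open>c P(A) \<le> E\<^sub>P X + e \<le> e\<close> and \<open>P(A) = 0\<close>. Working with \<open>c 1\<^sub>A\<close>
  in place of \<open>f\<close> avoids integrating \<open>f\<close>, which is bounded only outside a null set.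
\<close>

lemma (in prob_space) ESFA_imp_closure_trivial:
  assumes L: "rv_convex_cone L" "L \<noteq> {}" and bm: "L \<subseteq> bounded_measurable M"
    and P: "P \<in> ESFA M L"
  shows "Linfty_closure M (Linfty_minus_pos M L) \<inter> Linfty_pos M = Linfty_zero M"
proof (intro equalityI subsetI)
  fix f assume "f \<in> Linfty_zero M"
  then have f: "f \<in> Linfty M" "AE \<omega> in M. f \<omega> = 0" by (auto simp: Linfty_zero_def)
  have "(\<lambda>_. 0) \<in> Linfty_pos M" by (simp add: Linfty_pos_def bounded_measurable_Linfty)
  then have 0: "(\<lambda>\<omega>. 0 - 0) \<in> Linfty_minus_pos M L"
    using rv_convex_coneD(3)[OF L] unfolding Linfty_minus_pos_def
    by (intro CollectI exI[of _ "\<lambda>_. 0"]) simp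
  have "Linfty_norm M (\<lambda>\<omega>. f \<omega> - (0 - 0)) \<le> ereal 0"
    using f by (intro Linfty_norm_leI) (auto simp: Linfty_def)
  then have "Linfty_norm M (\<lambda>\<omega>. f \<omega> - (0 - 0)) < ereal e" if "0 < e" for e
    using that by (metis ereal_less(2) le_less_trans zero_ereal_def)
  then have "f \<in> Linfty_closure M (Linfty_minus_pos M L)"
    using f(1) 0 by (auto simp: Linfty_closure_def intro!: bexI[of _ "\<lambda>_. 0"])
  moreover have "f \<in> Linfty_pos M" using f by (auto simp: Linfty_pos_def)
  ultimately show "f \<in> Linfty_closure M (Linfty_minus_pos M L) \<inter> Linfty_pos M" by blast
next
  fix f assume "f \<in> Linfty_closure M (Linfty_minus_pos M L) \<inter> Linfty_pos M"
  then have f: "f \<in> Linfty M" "AE \<omega> in M. 0 \<le> f \<omega>"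
    and closure: "\<And>e. 0 < e \<Longrightarrow> \<exists>g\<in>Linfty_minus_pos M L. Linfty_norm M (\<lambda>\<omega>. f \<omega> - g \<omega>) < ereal e"
    by (auto simp: Linfty_pos_def Linfty_closure_def)
  have [measurable]: "f \<in> borel_measurable M" using f(1) by (simp add: Linfty_def)
  have P: "fa_prob M P" "fa_abs_cont M P (measure M)" "fa_abs_cont M (measure M) P"
    and PL: "\<And>X. X \<in> L \<Longrightarrow> fa_integral M P X \<le> 0"
    using P by (auto simp: ESFA_def fa_equiv_def)
  have "AE \<omega> in M. f \<omega> < c" if c: "0 < c" for c
  proof -
    define A where "A = {\<omega>\<in>space M. c \<le> f \<omega>}"
    have A: "A \<in> sets M" unfolding A_def by measurable
    let ?c = "\<lambda>\<omega>. c * indicator A \<omega> :: real"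
    have s: "simple_function M ?c" using A by auto
    have "fa_integral M P ?c = fa_simple_integral M P ?c"
      by (rule fa_integral_eqI[OF P(1)]) (auto simp: has_fa_integral_def s uniform_limit_const
          intro!: exI[of _ "\<lambda>_. ?c"])
    also have "\<dots> = (\<Sum>z\<in>(indicator A :: _ \<Rightarrow> real) ` space M.
        c * z * P {\<omega>\<in>space M. indicator A \<omega> = z})"
      using A by (intro fa_simple_integral_partition[OF P(1)]) auto
    also have "\<dots> = (\<Sum>z\<in>{0, 1::real}. c * z * P {\<omega>\<in>space M. indicator A \<omega> = z})"
    proof (rule sum.mono_neutral_left)
      have P0: "P {} = 0"
        using P(1) sets.empty_sets[of M] unfolding fa_prob_def additive_def
        by (metis Int_empty_left add_cancel_right_right sup_bot.right_neutral)
      show "\<forall>z\<in>{0, 1} - indicator A ` space M. c * z * P {\<omega> \<in> space M. indicator A \<omega> = z} = 0"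
      proof
        fix z :: real assume "z \<in> {0, 1} - indicator A ` space M"
        then have "{\<omega> \<in> space M. indicator A \<omega> = z} = {}" by auto
        then show "c * z * P {\<omega> \<in> space M. indicator A \<omega> = z} = 0"
          by (simp only: P0 mult_zero_right)
      qed
    qed (auto simp: indicator_def)
    finally have "fa_integral M P ?c
        = (\<Sum>z\<in>{0, 1::real}. c * z * P {\<omega>\<in>space M. indicator A \<omega> = z})" .
    moreover have "{\<omega>\<in>space M. indicator A \<omega> = (1::real)} = A"
      using sets.sets_into_space[OF A] by (auto simp: indicator_def)
    ultimately have eq: "fa_integral M P ?c = c * P A" by simp
    have small: "c * P A \<le> e" if e: "0 < e" for e
    proof -
      obtain X Z where XZ: "X \<in> L" "AE \<omega> in M. 0 \<le> Z \<omega>"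
        "Linfty_norm M (\<lambda>\<omega>. f \<omega> - (X \<omega> - Z \<omega>)) < ereal e"
        using closure[OF e] by (auto simp: Linfty_minus_pos_def Linfty_pos_def)
      have "AE \<omega> in M. ?c \<omega> \<le> X \<omega> + e"
        using XZ(2) Linfty_norm_less_imp_AE[OF XZ(3)] f(2)
        by eventually_elim (auto simp: A_def indicator_def)
      then have "fa_integral M P ?c \<le> fa_integral M P X + e"
        using bm XZ(1) simple_function_bounded_measurable[OF s]
        by (intro fa_integral_mono_AE[OF P(1,2)]) auto
      then show ?thesis using eq PL[OF XZ(1)] by simp
    qed
    have "c * P A \<le> 0" by (rule field_le_epsilon) (use small in simp)
    moreover have "0 \<le> P A" using P(1) A by (auto simp: fa_prob_def)
    ultimately have "P A = 0" using c by (simp add: mult_le_0_iff)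
    then have "measure M A = 0" using P(3) A by (auto simp: fa_abs_cont_def)
    then have "AE \<omega> in M. \<omega> \<notin> A" using A by (simp add: prob_eq_0)
    then show ?thesis using AE_space by eventually_elim (auto simp: A_def)
  qed
  then have "AE \<omega> in M. \<forall>n. f \<omega> < 1 / Suc n" by (subst AE_all_countable) auto
  then have "AE \<omega> in M. f \<omega> = 0"
    using f(2)
  proof eventually_elim
    case (elim \<omega>)
    have "f \<omega> \<le> 0"
    proof (rule ccontr)
      assume "\<not> f \<omega> \<le> 0"
      then obtain n where "1 / Suc n < f \<omega>" using nat_approx_posE[of "f \<omega>"] by auto
      then show False using elim(1) less_asym by blast
    qed
    then show ?case using elim by simp
  qed
  then show "f \<in> Linfty_zero M" using f by (simp add: Linfty_zero_def)
qed

section \<open>The closure condition bounds the cone in probability\<close>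

text \<open>
  Near-minimizers of \<open>E (f\<^sup>2)\<close> on a decreasing sequence of convex sets are close in \<open>L\<^sup>2\<close> by the
  parallelogram law: their midpoint lies in the larger of the two sets, so its norm cannot be much
  smaller than theirs. If the near-minimality is geometric, Markov's inequality and the
  Borel--Cantelli lemma turn this into almost sure convergence.
\<close>

lemma (in prob_space) decreasing_convex_AE_convergent_selection:
  fixes D :: "nat \<Rightarrow> ('a \<Rightarrow> real) set"
  assumes nonempty: "\<And>n. D n \<noteq> {}" and dec: "decseq D"
    and meas: "\<And>n f. f \<in> D n \<Longrightarrow> f \<in> borel_measurable M"
    and bound: "\<And>n f \<omega>. f \<in> D n \<Longrightarrow> \<bar>f \<omega>\<bar> \<le> 1"
    and midpoint: "\<And>n f g. f \<in> D n \<Longrightarrow> g \<in> D n \<Longrightarrow> (\<lambda>\<omega>. (f \<omega> + g \<omega>) / 2) \<in> D n"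
  obtains g where "\<And>n. g n \<in> D n" "AE \<omega> in M. convergent (\<lambda>n. g n \<omega>)"
proof -
  define E where "E f = (\<integral>\<omega>. (f \<omega>)\<^sup>2 \<partial>M)" for f :: "'a \<Rightarrow> real"
  have sq: "integrable M (\<lambda>\<omega>. (f \<omega>)\<^sup>2)" if "f \<in> borel_measurable M" "\<And>\<omega>. \<bar>f \<omega>\<bar> \<le> c"
    for f :: "'a \<Rightarrow> real" and c
  proof (rule integrable_const_bound)
    show "AE \<omega> in M. norm ((f \<omega>)\<^sup>2) \<le> c\<^sup>2"
      using order_trans[OF that(2) abs_ge_self] by (auto simp flip: abs_le_square_iff)
  qed (use that in measurable)
  have E_nonneg: "0 \<le> E f" for f unfolding E_def by (intro Bochner_Integration.integral_nonneg) simp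
  have E_le: "E f \<le> 1" if "f \<in> D n" for f n
  proof -
    have "E f \<le> (\<integral>\<omega>. 1 \<partial>M)"
      unfolding E_def using bound[OF that]
      by (intro integral_mono sq[of f 1] meas[OF that]) (auto simp: abs_square_le_1)
    then show ?thesis by (simp add: prob_space)
  qed
  define d where "d n = Inf (E ` D n)" for n
  have bdd: "bdd_below (E ` D n)" for n using E_nonneg by (intro bdd_belowI2)
  have d_le: "d n \<le> E f" if "f \<in> D n" for n f
    unfolding d_def using bdd that by (intro cINF_lower)
  have d_near: "\<exists>f\<in>D n. E f < d n + e" if "0 < e" for n e
    using cINF_less_iff[OF nonempty bdd, of n "d n + e"] that unfolding d_def by simp
  have "incseq d"
    unfolding d_def using decseqD[OF dec] by (intro incseq_SucI cINF_superset_mono nonempty bdd) auto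
  moreover have "d n \<le> 1" for n
  proof -
    obtain f where "f \<in> D n" using nonempty by blast
    then show ?thesis using d_le E_le by (meson order_trans)
  qed
  ultimately obtain l where l: "d \<longlonglongrightarrow> l" "\<And>n. d n \<le> l"
    using incseq_convergent by blast
  have "\<exists>m\<ge>j. l - (1 / 8) ^ j < d m" for j
  proof -
    have "eventually (\<lambda>m. l - (1 / 8) ^ j < d m) sequentially"
      by (rule order_tendstoD[OF l(1)]) simp
    then show ?thesis unfolding eventually_sequentially by (meson le_cases)
  qed
  \<comment> \<open>The rate \<open>8\<^sup>-\<^sup>j\<close> beats the factor \<open>4\<^sup>j\<close> that Markov's inequality costs below.\<close>
  then obtain m where m: "\<And>j. j \<le> m j" "\<And>j. l - (1 / 8) ^ j < d (m j)" by metis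
  have "\<exists>f\<in>D (m j). E f < d (m j) + (1 / 8) ^ j" for j by (rule d_near) simp
  then obtain g where g: "\<And>j. g j \<in> D (m j)" "\<And>j. E (g j) < d (m j) + (1 / 8) ^ j" by metis
  have E_g: "E (g j) \<le> l + (1 / 8) ^ j" for j using g(2)[of j] l(2)[of "m j"] by linarith
  have close: "E (\<lambda>\<omega>. g j \<omega> - g (Suc j) \<omega>) \<le> 8 * (1 / 8) ^ j" for j
  proof -
    \<comment> \<open>\<open>D q\<close> is the larger of the two sets, so it contains both functions and their midpoint.\<close>
    define q where "q = min (m j) (m (Suc j))"
    have "(1 / 8 :: real) ^ Suc j \<le> (1 / 8) ^ j" by simp
    then have "l - (1 / 8) ^ j \<le> d (m j)" "l - (1 / 8) ^ j \<le> d (m (Suc j))"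
      using m(2)[of j] m(2)[of "Suc j"] by linarith+
    then have q: "l - (1 / 8) ^ j \<le> d q" unfolding q_def min_def by simp
    have "g j \<in> D q" "g (Suc j) \<in> D q"
      using g(1) decseqD[OF dec, of q "m j"] decseqD[OF dec, of q "m (Suc j)"] by (auto simp: q_def)
    then have mid: "(\<lambda>\<omega>. (g j \<omega> + g (Suc j) \<omega>) / 2) \<in> D q" by (rule midpoint)
    have int: "integrable M (\<lambda>\<omega>. (g j \<omega>)\<^sup>2)" "integrable M (\<lambda>\<omega>. (g (Suc j) \<omega>)\<^sup>2)"
      "integrable M (\<lambda>\<omega>. ((g j \<omega> + g (Suc j) \<omega>) / 2)\<^sup>2)"
      using g(1) mid by (auto intro!: sq[of _ 1] meas bound)
    \<comment> \<open>The parallelogram law.\<close>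
    have "E (\<lambda>\<omega>. g j \<omega> - g (Suc j) \<omega>)
        = (\<integral>\<omega>. 2 * (g j \<omega>)\<^sup>2 + 2 * (g (Suc j) \<omega>)\<^sup>2 - 4 * ((g j \<omega> + g (Suc j) \<omega>) / 2)\<^sup>2 \<partial>M)"
      unfolding E_def
      by (intro Bochner_Integration.integral_cong) (simp_all add: power2_eq_square field_simps)
    also have "\<dots> = 2 * E (g j) + 2 * E (g (Suc j)) - 4 * E (\<lambda>\<omega>. (g j \<omega> + g (Suc j) \<omega>) / 2)"
      unfolding E_def using int by simp
    also have "\<dots> \<le> 8 * (1 / 8) ^ j"
      using E_g[of j] E_g[of "Suc j"] d_le[OF mid] q \<open>(1 / 8 :: real) ^ Suc j \<le> (1 / 8) ^ j\<close>
      by linarith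
    finally show ?thesis .
  qed
  have [measurable]: "g j \<in> borel_measurable M" for j using g(1) by (rule meas)
  define A where "A j = {\<omega>\<in>space M. (1 / 4) ^ j \<le> (g j \<omega> - g (Suc j) \<omega>)\<^sup>2}" for j
  have A[measurable]: "A j \<in> sets M" for j unfolding A_def by measurable
  have "measure M (A j) \<le> 8 * (1 / 2) ^ j" for j
  proof -
    have "\<bar>g j \<omega> - g (Suc j) \<omega>\<bar> \<le> 2" for \<omega>
      using bound[OF g(1), of j \<omega>] bound[OF g(1), of "Suc j" \<omega>] by linarith
    then have "measure M (A j) \<le> E (\<lambda>\<omega>. g j \<omega> - g (Suc j) \<omega>) / (1 / 4) ^ j"
      unfolding A_def E_def
      by (intro integral_Markov_inequality_measure[OF _ sets.empty_sets] sq[of _ 2]) auto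
    also have "\<dots> \<le> 8 * (1 / 8) ^ j / (1 / 4) ^ j"
      using close by (intro divide_right_mono) auto
    also have "(1 / 8 :: real) ^ j = (1 / 2) ^ j * (1 / 4) ^ j" by (simp flip: power_mult_distrib)
    finally show ?thesis by simp
  qed
  then have "summable (\<lambda>j. measure M (A j))"
    by (intro summable_comparison_test'[OF summable_mult[OF summable_geometric], of "1/2" 0]) auto
  then have "AE \<omega> in M. eventually (\<lambda>j. \<omega> \<in> space M - A j) sequentially"
    by (intro borel_cantelli_AE1) (auto simp: emeasure_eq_measure)
  then have "AE \<omega> in M. convergent (\<lambda>j. g j \<omega>)"
  proof eventually_elim
    case (elim \<omega>)
    have "eventually (\<lambda>j. norm (g (Suc j) \<omega> - g j \<omega>) \<le> (1 / 2) ^ j) sequentially"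
      using elim
    proof eventually_elim
      case (elim j)
      have "(1 / 4 :: real) ^ j = ((1 / 2) ^ j)\<^sup>2" by (simp add: power2_eq_square flip: power_mult_distrib)
      then have "(g (Suc j) \<omega> - g j \<omega>)\<^sup>2 \<le> ((1 / 2) ^ j)\<^sup>2"
        using elim by (auto simp: A_def power2_commute)
      then show ?case using power2_le_imp_le[of "\<bar>g (Suc j) \<omega> - g j \<omega>\<bar>"] by simp
    qed
    then have "summable (\<lambda>j. g (Suc j) \<omega> - g j \<omega>)"
      by (rule summable_comparison_test_ev) (intro summable_geometric, simp)
    then have "(\<lambda>n. \<Sum>j<n. g (Suc j) \<omega> - g j \<omega>) \<longlonglongrightarrow> (\<Sum>j. g (Suc j) \<omega> - g j \<omega>)"
      by (rule summable_LIMSEQ)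
    then have "(\<lambda>n. (g n \<omega> - g 0 \<omega>) + g 0 \<omega>) \<longlonglongrightarrow> (\<Sum>j. g (Suc j) \<omega> - g j \<omega>) + g 0 \<omega>"
      by (intro tendsto_add tendsto_const) (simp add: sum_lessThan_telescope[of "\<lambda>n. g n \<omega>"])
    then show ?case by (auto simp: convergent_def)
  qed
  moreover have "g n \<in> D n" for n using g(1)[of n] decseqD[OF dec m(1)[of n]] by blast
  ultimately show ?thesis using that by blast
qed

text \<open>
  If the bound fails for every \<open>b\<close>, truncating \<open>X / b\<close> to \<open>[-1, 1]\<close> gives elements of the sets
  \<open>D n\<close> below: functions under some member of \<open>L\<close>, at least \<open>-1/(n+1)\<close>, with mean at least
  \<open>e/2\<close>. An almost surely convergent selection \<open>g n \<in> D n\<close> has a limit with mean at least \<open>e/2\<close>, so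
  for some \<open>m\<close> the event \<open>B m\<close> on which \<open>g n \<ge> e/4\<close> for all \<open>n \<ge> m\<close> has positive probability. But
  \<open>e/4\<close> times the indicator of \<open>B m\<close> is within \<open>1/(n+1)\<close> of the minimum of itself and \<open>g n\<close>,
  which lies in \<open>L - L\<^sub>\<infinity>\<^sup>+\<close>; it is therefore in the closure.
\<close>

lemma (in prob_space) closure_trivial_imp_bounded_in_probability:
  assumes L: "rv_convex_cone L" "L \<noteq> {}" and bm: "L \<subseteq> bounded_measurable M"
    and trivial: "Linfty_closure M (Linfty_minus_pos M L) \<inter> Linfty_pos M = Linfty_zero M"
    and e: "0 < e"
  obtains b where "0 \<le> b"
    "\<And>X. X \<in> L \<Longrightarrow> AE \<omega> in M. -1 \<le> X \<omega> \<Longrightarrow> measure M {\<omega>\<in>space M. b < X \<omega>} < e"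
proof (rule ccontr)
  assume "\<not> thesis"
  with that have large: "\<exists>X\<in>L. (AE \<omega> in M. -1 \<le> X \<omega>) \<and> e \<le> measure M {\<omega>\<in>space M. b < X \<omega>}"
    if "0 \<le> b" for b
    using \<open>0 \<le> b\<close> by (meson not_less)
  define D where "D n = {g \<in> borel_measurable M. (\<forall>\<omega>. \<bar>g \<omega>\<bar> \<le> 1) \<and> e / 2 \<le> (\<integral>\<omega>. g \<omega> \<partial>M) \<and>
    (AE \<omega> in M. - (1 / real (Suc n)) \<le> g \<omega>) \<and> (\<exists>X\<in>L. AE \<omega> in M. g \<omega> \<le> X \<omega>)}" for n
  have DI: "g \<in> D n"
    if "g \<in> borel_measurable M" "\<And>\<omega>. \<bar>g \<omega>\<bar> \<le> 1" "e / 2 \<le> (\<integral>\<omega>. g \<omega> \<partial>M)"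
      "AE \<omega> in M. - (1 / real (Suc n)) \<le> g \<omega>" "X \<in> L" "AE \<omega> in M. g \<omega> \<le> X \<omega>" for g n X
    unfolding D_def by (intro CollectI conjI bexI[where x = X] allI that)
  have int: "integrable M g" if "g \<in> borel_measurable M" "\<And>\<omega>. \<bar>g \<omega>\<bar> \<le> 1" for g :: "'a \<Rightarrow> real"
    using that by (intro integrable_bounded_measurable bounded_measurableI)
  have nonempty: "D n \<noteq> {}" for n
  proof -
    obtain N where N: "1 / real (Suc N) < e / 2" using nat_approx_posE[of "e / 2"] e by auto
    define b where "b = real (Suc (max n N))"
    have b: "0 < b" "1 / b \<le> 1 / real (Suc n)" "1 / b \<le> e / 2"
    proof -
      have "1 / b \<le> 1 / real (Suc N)" unfolding b_def by (intro divide_left_mono) auto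
      then show "1 / b \<le> e / 2" using N by simp
      show "1 / b \<le> 1 / real (Suc n)" unfolding b_def by (intro divide_left_mono) auto
    qed (simp add: b_def)
    have b1: "1 \<le> b" by (simp add: b_def)
    obtain X where X: "X \<in> L" "AE \<omega> in M. -1 \<le> X \<omega>" "e \<le> measure M {\<omega>\<in>space M. b < X \<omega>}"
      using large[of b] b by auto
    have [measurable]: "X \<in> borel_measurable M" using X bm by (auto simp: bounded_measurable_def)
    define g where "g \<omega> = max (- 1) (min 1 (1 / b * X \<omega>))" for \<omega>
    have g[measurable]: "g \<in> borel_measurable M" unfolding g_def by measurable
    have g1: "\<bar>g \<omega>\<bar> \<le> 1" for \<omega> by (simp add: g_def)
    have lower: "AE \<omega> in M. - (1 / b) \<le> g \<omega>"
      using X(2)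
    proof eventually_elim
      case (elim \<omega>)
      have "- (1 / b) \<le> 1 / b * X \<omega>" using mult_left_mono[OF elim, of "1 / b"] b(1) by simp
      moreover have "- (1 / b) \<le> 1" using b(1) by (intro order_trans[of "- (1 / b)" 0 1]) auto
      ultimately show ?case by (simp add: g_def le_max_iff_disj)
    qed
    have upper: "AE \<omega> in M. g \<omega> \<le> 1 / b * X \<omega>"
      using X(2)
    proof eventually_elim
      case (elim \<omega>)
      have "- 1 \<le> 1 / b * X \<omega>" using b1 elim by (simp add: field_simps)
      then show ?case by (simp add: g_def)
    qed
    have ind: "integrable M (indicat_real {\<omega>\<in>space M. b < X \<omega>})"
      by (intro integrable_bounded_measurable bounded_measurable_indicator) measurable
    have "e - 1 / b \<le> measure M {\<omega>\<in>space M. b < X \<omega>} - 1 / b" using X by simp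
    also have "\<dots> = (\<integral>\<omega>. indicator {\<omega>\<in>space M. b < X \<omega>} \<omega> - 1 / b \<partial>M)"
      using ind by (simp add: prob_space)
    also have "\<dots> \<le> (\<integral>\<omega>. g \<omega> \<partial>M)"
    proof (rule integral_mono_AE)
      show "AE \<omega> in M. indicator {\<omega>\<in>space M. b < X \<omega>} \<omega> - 1 / b \<le> g \<omega>"
        using lower
      proof eventually_elim
        case (elim \<omega>)
        show ?case
        proof (cases "b < X \<omega>")
          case True
          then have "g \<omega> = 1" using b(1) by (simp add: g_def field_simps)
          moreover have "0 \<le> 1 / b" "indicator {\<omega>\<in>space M. b < X \<omega>} \<omega> \<le> (1::real)"
            using b(1) by (auto simp: indicator_le_1)
          ultimately show ?thesis by linarith
        qed (use elim in simp)
      qed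
    qed (use int[OF g g1] ind in simp_all)
    finally have "e / 2 \<le> (\<integral>\<omega>. g \<omega> \<partial>M)" using b by simp
    moreover have "AE \<omega> in M. - (1 / real (Suc n)) \<le> g \<omega>"
      using lower by eventually_elim (use b(2) in linarith)
    moreover have "(\<lambda>\<omega>. 1 / b * X \<omega>) \<in> L" using X b by (intro rv_convex_coneD[OF L(1)]) auto
    ultimately have "g \<in> D n" by (intro DI[OF g g1 _ _ _ upper])
    then show ?thesis by blast
  qed
  have dec: "decseq D"
  proof (rule decseq_SucI, rule subsetI)
    fix n g assume g: "g \<in> D (Suc n)"
    have "1 / real (Suc (Suc n)) \<le> 1 / real (Suc n)" by (intro divide_left_mono) auto
    moreover have "AE \<omega> in M. - (1 / real (Suc (Suc n))) \<le> g \<omega>" using g by (simp add: D_def)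
    ultimately have "AE \<omega> in M. - (1 / real (Suc n)) \<le> g \<omega>"
      by (elim eventually_mono) linarith
    then show "g \<in> D n" using g unfolding D_def by blast
  qed
  have midpoint: "(\<lambda>\<omega>. (f \<omega> + g \<omega>) / 2) \<in> D n" if fg: "f \<in> D n" "g \<in> D n" for n f g
  proof -
    obtain X Y where XY: "X \<in> L" "AE \<omega> in M. f \<omega> \<le> X \<omega>" "Y \<in> L" "AE \<omega> in M. g \<omega> \<le> Y \<omega>"
      using fg by (auto simp: D_def)
    have f: "f \<in> borel_measurable M" "\<And>\<omega>. \<bar>f \<omega>\<bar> \<le> 1" "e / 2 \<le> (\<integral>\<omega>. f \<omega> \<partial>M)"
      "AE \<omega> in M. - (1 / real (Suc n)) \<le> f \<omega>"
      and g: "g \<in> borel_measurable M" "\<And>\<omega>. \<bar>g \<omega>\<bar> \<le> 1" "e / 2 \<le> (\<integral>\<omega>. g \<omega> \<partial>M)"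
      "AE \<omega> in M. - (1 / real (Suc n)) \<le> g \<omega>"
      using fg by (auto simp: D_def)
    have "(\<lambda>\<omega>. 1 / 2 * X \<omega> + 1 / 2 * Y \<omega>) \<in> L"
      using XY by (intro rv_convex_cone_combination[OF L(1)]) auto
    moreover have "AE \<omega> in M. (f \<omega> + g \<omega>) / 2 \<le> 1 / 2 * X \<omega> + 1 / 2 * Y \<omega>"
      using XY(2,4) by eventually_elim simp
    moreover have "AE \<omega> in M. - (1 / real (Suc n)) \<le> (f \<omega> + g \<omega>) / 2"
      using f(4) g(4)
    proof eventually_elim
      case (elim \<omega>)
      define c where "c = - (1 / real (Suc n))"
      have "c \<le> f \<omega>" "c \<le> g \<omega>" using elim unfolding c_def by blast+
      then have "c \<le> (f \<omega> + g \<omega>) / 2" by (simp add: pos_le_divide_eq)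
      then show ?case unfolding c_def .
    qed
    moreover have "\<bar>(f \<omega> + g \<omega>) / 2\<bar> \<le> 1" for \<omega> 
      using f(2)[of \<omega>] g(2)[of \<omega>] by (simp add: abs_le_iff)
    moreover have "e / 2 \<le> (\<integral>\<omega>. (f \<omega> + g \<omega>) / 2 \<partial>M)"
      using f(3) g(3) int[OF f(1,2)] int[OF g(1,2)] by simp
    ultimately show ?thesis using f(1) g(1)
      by (intro DI[of _ _ "\<lambda>\<omega>. 1 / 2 * X \<omega> + 1 / 2 * Y \<omega>"]) auto
  qed
  obtain g where gD: "\<And>n. g n \<in> D n" and conv: "AE \<omega> in M. convergent (\<lambda>n. g n \<omega>)"
    using decreasing_convex_AE_convergent_selection[OF nonempty dec _ _ midpoint]
    unfolding D_def by blast
  have g[measurable]: "\<And>n. g n \<in> borel_measurable M" and g1: "\<And>n \<omega>. \<bar>g n \<omega>\<bar> \<le> 1"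
    and gE: "\<And>n. e / 2 \<le> (\<integral>\<omega>. g n \<omega> \<partial>M)"
    and g_lower: "\<And>n. AE \<omega> in M. - (1 / real (Suc n)) \<le> g n \<omega>"
    and g_upper: "\<And>n. \<exists>X\<in>L. AE \<omega> in M. g n \<omega> \<le> X \<omega>"
    using gD unfolding D_def by blast+
  define B where "B m = {\<omega>\<in>space M. \<forall>n\<ge>m. e / 4 \<le> g n \<omega>}" for m
  have B[measurable]: "B m \<in> sets M" for m unfolding B_def by measurable
  have null: "AE \<omega> in M. \<omega> \<notin> B m" for m
  proof -
    let ?f = "\<lambda>\<omega>. e / 4 * indicator (B m) \<omega>"
    have f_bm: "?f \<in> bounded_measurable M"
      by (intro bounded_measurable_closed bounded_measurable_indicator B)
    have "?f \<in> Linfty_closure M (Linfty_minus_pos M L)"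
      unfolding Linfty_closure_def
    proof (intro CollectI conjI allI impI)
      show "?f \<in> Linfty M" using f_bm by (rule bounded_measurable_Linfty)
      fix c :: real assume "0 < c"
      then obtain N where N: "1 / real (Suc N) < c" using nat_approx_posE by blast
      define n where "n = max m N"
      have "1 / real (Suc n) \<le> 1 / real (Suc N)" unfolding n_def by (intro divide_left_mono) auto
      then have n: "1 / real (Suc n) < c" "m \<le> n" using N by (auto simp: n_def)
      \<comment> \<open>On \<open>B m\<close> this is \<open>?f\<close>; elsewhere it is \<open>min (g n) 0\<close>, which is uniformly small.\<close>
      define h where "h \<omega> = min (g n \<omega>) (?f \<omega>)" for \<omega>
      have [measurable]: "h \<in> borel_measurable M" unfolding h_def by measurable
      obtain X where X: "X \<in> L" "AE \<omega> in M. g n \<omega> \<le> X \<omega>" using g_upper by blast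
      have h_bm: "h \<in> bounded_measurable M"
      proof (rule bounded_measurableI)
        show "\<bar>h \<omega>\<bar> \<le> 1 + e" for \<omega>
          using g1[of n \<omega>] e by (auto simp: h_def indicator_def min_def)
      qed simp
      have "(\<lambda>\<omega>. X \<omega> - h \<omega>) \<in> Linfty_pos M"
        unfolding Linfty_pos_def
      proof (intro CollectI conjI)
        show "(\<lambda>\<omega>. X \<omega> - h \<omega>) \<in> Linfty M"
          using X(1) bm h_bm by (intro bounded_measurable_Linfty bounded_measurable_closed) auto
        show "AE \<omega> in M. 0 \<le> X \<omega> - h \<omega>" using X(2) by eventually_elim (simp add: h_def)
      qed
      then have "(\<lambda>\<omega>. X \<omega> - (X \<omega> - h \<omega>)) \<in> Linfty_minus_pos M L"
        unfolding Linfty_minus_pos_def using X(1)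
        by (intro CollectI exI[of _ X] exI[of _ "\<lambda>\<omega>. X \<omega> - h \<omega>"]) simp
      then have h: "h \<in> Linfty_minus_pos M L" by simp
      have "AE \<omega> in M. \<bar>?f \<omega> - h \<omega>\<bar> \<le> 1 / real (Suc n)"
        using g_lower[of n]
      proof eventually_elim
        case (elim \<omega>)
        show ?case
        proof (cases "\<omega> \<in> B m")
          case True
          then have "h \<omega> = ?f \<omega>" using n(2) by (simp add: h_def B_def)
          then show ?thesis by (simp only: diff_self abs_zero) simp
        next
          case False
          have "0 \<le> 1 / real (Suc n)" by simp
          with False elim show ?thesis by (simp add: h_def min_def)
        qed
      qed
      then have "Linfty_norm M (\<lambda>\<omega>. ?f \<omega> - h \<omega>) \<le> ereal (1 / real (Suc n))"
        by (intro Linfty_norm_leI) measurable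
      also have "\<dots> < ereal c" using n(1) by simp
      finally show "\<exists>h\<in>Linfty_minus_pos M L. Linfty_norm M (\<lambda>\<omega>. ?f \<omega> - h \<omega>) < ereal c"
        using h by blast
    qed
    moreover have "?f \<in> Linfty_pos M"
      using bounded_measurable_Linfty[OF f_bm] e by (simp add: Linfty_pos_def)
    ultimately have "?f \<in> Linfty_zero M" using trivial by blast
    then have "AE \<omega> in M. ?f \<omega> = 0" by (simp add: Linfty_zero_def)
    then show ?thesis by eventually_elim (use e in \<open>simp add: indicator_def split: if_splits\<close>)
  qed
  define h where "h \<omega> = lim (\<lambda>n. g n \<omega>)" for \<omega>
  have [measurable]: "h \<in> borel_measurable M" unfolding h_def by measurable
  have lim: "AE \<omega> in M. (\<lambda>n. g n \<omega>) \<longlonglongrightarrow> h \<omega>"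
    using conv by eventually_elim (simp add: h_def convergent_LIMSEQ_iff)
  have dom: "integrable M h" "(\<lambda>n. \<integral>\<omega>. g n \<omega> \<partial>M) \<longlonglongrightarrow> (\<integral>\<omega>. h \<omega> \<partial>M)"
    using g1 by (intro integrable_dominated_convergence[OF _ _ _ lim, of "\<lambda>_. 1"]
      integral_dominated_convergence[OF _ _ _ lim, of "\<lambda>_. 1"]; simp)+
  have "AE \<omega> in M. \<forall>m. \<omega> \<notin> B m" using null by (subst AE_all_countable) blast
  then have "AE \<omega> in M. h \<omega> \<le> e / 4"
    using lim AE_space
  proof eventually_elim
    case (elim \<omega>)
    show ?case
    proof (rule ccontr)
      assume "\<not> h \<omega> \<le> e / 4"
      then have "eventually (\<lambda>n. e / 4 < g n \<omega>) sequentially"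
        using elim(2) by (intro order_tendstoD) auto
      then obtain m where "\<And>n. m \<le> n \<Longrightarrow> e / 4 < g n \<omega>" by (auto simp: eventually_sequentially)
      then have "\<omega> \<in> B m" using elim(3) by (auto simp: B_def intro: less_imp_le)
      then show False using elim(1) by blast
    qed
  qed
  then have "(\<integral>\<omega>. h \<omega> \<partial>M) \<le> (\<integral>\<omega>. e / 4 \<partial>M)" using dom(1) by (intro integral_mono_AE) auto
  then have "(\<integral>\<omega>. h \<omega> \<partial>M) \<le> e / 4" by (simp add: prob_space)
  moreover have "e / 2 \<le> (\<integral>\<omega>. h \<omega> \<partial>M)" by (rule LIMSEQ_le_const[OF dom(2)]) (use gE in blast)
  ultimately show False using e by simp
qed

section \<open>Tightness as boundedness in probability\<close>

lemma (in prob_space) bounded_in_probability_imp_tight_laws: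
  assumes meas: "L \<subseteq> borel_measurable M"
    and bound: "\<And>e. 0 < e \<Longrightarrow> \<exists>b. \<forall>X\<in>L. (AE \<omega> in M. -1 \<le> X \<omega>) \<longrightarrow>
      measure M {\<omega>\<in>space M. b < X \<omega>} < e"
  shows "tight_laws {distr M borel X | X. X \<in> L \<and> (AE \<omega> in M. -1 \<le> X \<omega>)}"
  unfolding tight_laws_def
proof (intro conjI ballI allI impI)
  fix \<mu> assume "\<mu> \<in> {distr M borel X | X. X \<in> L \<and> (AE \<omega> in M. -1 \<le> X \<omega>)}"
  then show "real_distribution \<mu>" using meas by auto
next
  fix e :: real assume "0 < e"
  then obtain b where b: "\<And>X. X \<in> L \<Longrightarrow> AE \<omega> in M. -1 \<le> X \<omega> \<Longrightarrow>
      measure M {\<omega>\<in>space M. b < X \<omega>} < e"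
    using bound by blast
  have "1 - e < measure (distr M borel X) {-1..b}" if X: "X \<in> L" "AE \<omega> in M. -1 \<le> X \<omega>" for X
  proof -
    have [measurable]: "X \<in> borel_measurable M" using X meas by blast
    have "AE \<omega> in M. X \<omega> \<in> {-1..b} \<or> b < X \<omega>" using X(2) by eventually_elim auto
    then have "1 = measure M {\<omega>\<in>space M. X \<omega> \<in> {-1..b} \<or> b < X \<omega>}"
      by (intro prob_Collect_eq_1[THEN iffD2, symmetric]) measurable
    also have "\<dots> \<le> measure M {\<omega>\<in>space M. X \<omega> \<in> {-1..b}} + measure M {\<omega>\<in>space M. b < X \<omega>}"
      by (intro order_trans[OF finite_measure_mono measure_Un_le]) auto
    also have "measure M {\<omega>\<in>space M. X \<omega> \<in> {-1..b}} = measure (distr M borel X) {-1..b}"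
      by (subst measure_distr) (auto intro!: arg_cong[where f = "measure M"])
    finally show ?thesis using b[OF X] by simp
  qed
  then show "\<exists>K. compact K \<and> (\<forall>\<mu>\<in>{distr M borel X | X. X \<in> L \<and> (AE \<omega> in M. -1 \<le> X \<omega>)}.
      1 - e < measure \<mu> K)"
    by (intro exI[of _ "{-1..b}"]) auto
qed

lemma (in prob_space) tight_laws_imp_bounded_in_probability:
  assumes meas: "L \<subseteq> borel_measurable M"
    and tight: "tight_laws {distr M borel X | X. X \<in> L \<and> (AE \<omega> in M. -1 \<le> X \<omega>)}"
    and e: "0 < e"
  obtains b where "0 \<le> b"
    "\<And>X. X \<in> L \<Longrightarrow> AE \<omega> in M. -1 \<le> X \<omega> \<Longrightarrow> measure M {\<omega>\<in>space M. b < X \<omega>} \<le> e"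
proof -
  define \<Gamma> where "\<Gamma> = {distr M borel X | X. X \<in> L \<and> (AE \<omega> in M. -1 \<le> X \<omega>)}"
  have "\<exists>K. compact K \<and> (\<forall>\<mu>\<in>\<Gamma>. 1 - e < measure \<mu> K)"
    using tight e unfolding \<Gamma>_def[symmetric] tight_laws_def by blast
  then obtain K where K: "compact K" "\<And>\<mu>. \<mu> \<in> \<Gamma> \<Longrightarrow> 1 - e < measure \<mu> K" by blast
  obtain a where a: "\<And>x. x \<in> K \<Longrightarrow> \<bar>x\<bar> \<le> a"
    using compact_imp_bounded[OF K(1)] by (auto simp: bounded_iff)
  have K_borel: "K \<in> sets borel" using K(1) by (intro borel_closed compact_imp_closed)
  show ?thesis
  proof
    show "0 \<le> max 0 a" by simp
    fix X assume X: "X \<in> L" "AE \<omega> in M. -1 \<le> X \<omega>"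
    have [measurable]: "X \<in> borel_measurable M" using X meas by blast
    let ?G = "X -` K \<inter> space M"
    have G: "?G \<in> sets M" using K_borel by measurable
    have "measure M {\<omega>\<in>space M. max 0 a < X \<omega>} \<le> measure M (space M - ?G)"
      using G a by (intro finite_measure_mono) force+
    also have "\<dots> = 1 - measure (distr M borel X) K"
      using G K_borel by (simp add: prob_compl measure_distr)
    also have "\<dots> \<le> e"
    proof -
      have "distr M borel X \<in> \<Gamma>" unfolding \<Gamma>_def using X by blast
      then show ?thesis using K(2) by fastforce
    qed
    finally show "measure M {\<omega>\<in>space M. max 0 a < X \<omega>} \<le> e" .
  qed
qed

section \<open>The essential supremum as a sublinear functional\<close>

definition (in prob_space) real_esssup :: "('a \<Rightarrow> real) \<Rightarrow> real" where
  "real_esssup f = real_of_ereal (esssup M (\<lambda>\<omega>. ereal (f \<omega>)))"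

lemma (in prob_space) esssup_eq_real_esssup:
  assumes f: "f \<in> bounded_measurable M"
  shows "esssup M (\<lambda>\<omega>. ereal (f \<omega>)) = ereal (real_esssup f)"
proof -
  obtain c where c: "f \<in> borel_measurable M" "\<forall>x\<in>space M. \<bar>f x\<bar> \<le> c"
    using f by (auto simp: bounded_measurable_iff)
  have "esssup M (\<lambda>\<omega>. ereal (f \<omega>)) \<le> ereal c"
    using c by (intro esssup_I AE_I2) (auto simp: abs_le_iff)
  moreover have "ereal (- c) = esssup M (\<lambda>\<omega>. ereal (- c))"
    by (rule esssup_const[symmetric]) (simp add: emeasure_space_1)
  moreover have "\<dots> \<le> esssup M (\<lambda>\<omega>. ereal (f \<omega>))"
    using c by (intro esssup_AE_mono AE_I2) (auto simp: abs_le_iff)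
  ultimately show ?thesis
    unfolding real_esssup_def by (cases "esssup M (\<lambda>\<omega>. ereal (f \<omega>))") auto
qed

lemma (in prob_space) real_esssup_AE:
  assumes "f \<in> bounded_measurable M"
  shows "AE \<omega> in M. f \<omega> \<le> real_esssup f"
  using esssup_AE[of "\<lambda>\<omega>. ereal (f \<omega>)" M] by (simp add: esssup_eq_real_esssup[OF assms])

lemma (in prob_space) real_esssup_leI:
  assumes "f \<in> bounded_measurable M" "AE \<omega> in M. f \<omega> \<le> c"
  shows "real_esssup f \<le> c"
proof -
  have "esssup M (\<lambda>\<omega>. ereal (f \<omega>)) \<le> ereal c"
    using assms by (intro esssup_I) (auto simp: bounded_measurable_def)
  then show ?thesis by (simp add: esssup_eq_real_esssup[OF assms(1)])
qed

lemma (in prob_space) sublinear_on_real_esssup: "sublinear_on (bounded_measurable M) real_esssup"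
  unfolding sublinear_on_def
proof (intro conjI ballI allI impI)
  fix f g assume fg: "f \<in> bounded_measurable M" "g \<in> bounded_measurable M"
  have "AE x in M. f x + g x \<le> real_esssup f + real_esssup g"
    using real_esssup_AE[OF fg(1)] real_esssup_AE[OF fg(2)] by eventually_elim (rule add_mono)
  then show "real_esssup (\<lambda>x. f x + g x) \<le> real_esssup f + real_esssup g"
    by (intro real_esssup_leI bounded_measurable_closed fg)
next
  fix f and c :: real assume f: "f \<in> bounded_measurable M" and c: "0 < c"
  have "AE x in M. c * f x \<le> c * real_esssup f"
    using real_esssup_AE[OF f] by eventually_elim (use c in simp)
  then show "real_esssup (\<lambda>x. c * f x) \<le> c * real_esssup f"
    by (intro real_esssup_leI bounded_measurable_closed f)
qed

section \<open>From boundedness in probability to domination on large events\<close>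

text \<open>
  Domination by the countably additive \<open>M\<close> forces continuity at the empty set, so \<open>\<phi>\<close> restricted to
  indicators is a measure, and Radon--Nikodym supplies the density.
\<close>

lemma (in prob_space) dominated_positive_functional_density:
  assumes \<phi>: "positive_functional M \<phi>"
    and le: "\<And>A. A \<in> sets M \<Longrightarrow> \<phi> (indicator A) \<le> measure M A"
  obtains g :: "'a \<Rightarrow> real" where "g \<in> borel_measurable M" "\<And>\<omega>. 0 \<le> g \<omega>"
    "\<And>f. f \<in> bounded_measurable M \<Longrightarrow> integrable M (\<lambda>\<omega>. g \<omega> * f \<omega>)"
    "\<And>f. f \<in> bounded_measurable M \<Longrightarrow> \<phi> f = (\<integral>\<omega>. g \<omega> * f \<omega> \<partial>M)"
proof -
  define \<nu> where "\<nu> A = ennreal (\<phi> (indicator A))" for A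
  have nonneg: "0 \<le> \<phi> (indicator A)" if "A \<in> sets M" for A
    using that by (intro positive_functionalD(3)[OF \<phi>] bounded_measurable_indicator) auto
  have empty: "\<phi> (indicator {}) = 0"
    using le[of "{}"] nonneg[of "{}"] by simp
  have positive: "positive (sets M) \<nu>"
    using empty by (simp add: positive_def \<nu>_def)
  have "countably_additive (sets M) \<nu>"
  proof (rule sets.empty_continuous_imp_countably_additive[OF positive])
    show "additive (sets M) \<nu>"
      unfolding additive_def \<nu>_def
      by (simp add: indicator_union_disjoint positive_functionalD(1)[OF \<phi>]
          bounded_measurable_indicator nonneg)
    show "\<forall>A\<in>sets M. \<nu> A \<noteq> \<infinity>" by (simp add: \<nu>_def)
    fix A :: "nat \<Rightarrow> 'a set"
    assume A: "range A \<subseteq> sets M" "decseq A" "(\<Inter>i. A i) = {}"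
    have lim: "(\<lambda>i. measure M (A i)) \<longlonglongrightarrow> 0"
      using finite_Lim_measure_decseq[OF A(1,2)] A(3) by simp
    have "(\<lambda>i. \<phi> (indicator (A i))) \<longlonglongrightarrow> 0"
      by (rule tendsto_sandwich[OF _ _ tendsto_const lim])
        (use A(1) nonneg le in \<open>auto intro!: always_eventually\<close>)
    then show "(\<lambda>i. \<nu> (A i)) \<longlonglongrightarrow> 0"
      unfolding \<nu>_def using tendsto_ennrealI by fastforce
  qed
  define N where "N = measure_of (space M) (sets M) \<nu>"
  have sets_N: "sets N = sets M" and space_N: "space N = space M"
    by (simp_all add: N_def sets.sets_measure_of_eq sets.space_measure_of_eq)
  have N: "emeasure N A = \<nu> A" if "A \<in> sets M" for A
    using that positive \<open>countably_additive (sets M) \<nu>\<close>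
    by (intro emeasure_measure_of[OF N_def]) (auto simp: sets_N sets.space_closed)
  interpret N: finite_measure N
    by (rule finite_measureI) (simp add: space_N N \<nu>_def)
  have "absolutely_continuous M N"
    unfolding absolutely_continuous_def
  proof
    fix A assume "A \<in> null_sets M"
    then have A: "A \<in> sets M" "measure M A = 0" by (auto simp: measure_eq_0_null_sets)
    then have "\<phi> (indicator A) \<le> 0" using le[OF A(1)] by simp
    then show "A \<in> null_sets N" using A by (simp add: null_sets_def sets_N N \<nu>_def ennreal_eq_0_iff)
  qed
  then obtain h where h: "h \<in> borel_measurable M" "density M h = N"
    using Radon_Nikodym_finite_measure[OF N.finite_measure_axioms sets_N] by blast
  have "(\<integral>\<^sup>+\<omega>. h \<omega> \<partial>M) = emeasure N (space M)"
    using h(1) by (simp flip: h(2) add: emeasure_density cong: nn_integral_cong)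
  then have "AE \<omega> in M. h \<omega> \<noteq> \<infinity>"
    using h(1) N[of "space M"] by (intro nn_integral_PInf_AE) (auto simp: \<nu>_def)
  define g where "g \<omega> = enn2real (h \<omega>)" for \<omega>
  have g[measurable]: "g \<in> borel_measurable M" unfolding g_def using h(1) by measurable
  have N_eq: "N = density M (\<lambda>\<omega>. ennreal (g \<omega>))"
    unfolding h(2)[symmetric]
  proof (rule density_cong)
    show "AE \<omega> in M. h \<omega> = ennreal (g \<omega>)"
      using \<open>AE \<omega> in M. h \<omega> \<noteq> \<infinity>\<close> by eventually_elim (simp add: g_def less_top)
  qed (use h in auto)
  have bm_N: "bounded_measurable N = bounded_measurable M"
    by (simp add: bounded_measurable_def space_N measurable_cong_sets[OF sets_N refl])
  have bm: "integrable N f" "f \<in> borel_measurable M" if "f \<in> bounded_measurable M" for f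
  proof -
    show "integrable N f" using that unfolding bm_N[symmetric] by (rule N.integrable_bounded_measurable)
    show "f \<in> borel_measurable M" using that unfolding bounded_measurable_def by blast
  qed
  show ?thesis
  proof
    show "g \<in> borel_measurable M" by (rule g)
    show "0 \<le> g \<omega>" for \<omega> by (simp add: g_def)
    fix f assume f: "f \<in> bounded_measurable M"
    show "integrable M (\<lambda>\<omega>. g \<omega> * f \<omega>)"
      using bm[OF f] integrable_density[of f M g] by (simp add: N_eq g_def)
    have "\<phi> f = (\<integral>\<omega>. f \<omega> \<partial>N)"
    proof (rule positive_functional_eqI[OF prob_space_axioms \<phi> _ _ f])
      show "positive_functional M (\<lambda>f. \<integral>\<omega>. f \<omega> \<partial>N)"
        using N.finite_measure_axioms sets_N by (rule positive_functional_integral)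
      show "\<phi> (indicator A) = (\<integral>\<omega>. indicator A \<omega> \<partial>N)" if "A \<in> sets M" for A
        using that N[OF that] nonneg[OF that] sets.sets_into_space[OF that]
        by (simp add: \<nu>_def measure_def space_N Int_absorb2)
    qed
    also have "\<dots> = (\<integral>\<omega>. g \<omega> * f \<omega> \<partial>M)"
      using bm[OF f] integral_density[of f M g] by (simp add: N_eq g_def)
    finally show "\<phi> f = (\<integral>\<omega>. g \<omega> * f \<omega> \<partial>M)" .
  qed
qed

lemma (in prob_space) sublinear_on_integral_pos_part:
  "sublinear_on (bounded_measurable M) (\<lambda>f. \<integral>\<omega>. max 0 (f \<omega>) \<partial>M)"
  unfolding sublinear_on_def
proof (intro conjI ballI allI impI)
  fix f g assume fg: "f \<in> bounded_measurable M" "g \<in> bounded_measurable M"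
  note int = integrable_bounded_measurable[OF fg(1)] integrable_bounded_measurable[OF fg(2)]
  have "(\<integral>\<omega>. max 0 (f \<omega> + g \<omega>) \<partial>M) \<le> (\<integral>\<omega>. max 0 (f \<omega>) + max 0 (g \<omega>) \<partial>M)"
    using int by (intro integral_mono Bochner_Integration.integrable_add integrable_max) auto
  then show "(\<integral>\<omega>. max 0 (f \<omega> + g \<omega>) \<partial>M) \<le> (\<integral>\<omega>. max 0 (f \<omega>) \<partial>M) + (\<integral>\<omega>. max 0 (g \<omega>) \<partial>M)"
    using int by simp
next
  fix f and c :: real assume c: "0 < c"
  have "max 0 (c * x) = c * max 0 x" for x :: real
    using c by (auto simp: max_def zero_le_mult_iff mult_le_0_iff)
  then show "(\<integral>\<omega>. max 0 (c * f \<omega>) \<partial>M) \<le> c * (\<integral>\<omega>. max 0 (f \<omega>) \<partial>M)" by simp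
qed

text \<open>
  The constraints \<open>\<phi> f \<le> b\<close> for \<open>f \<in> C\<close> and \<open>\<phi> (-1) \<le> -(1 - e)\<close> generate a cone. A member
  \<open>t f - s\<close> of it is consistent with \<open>r h = E (max 0 h)\<close> because on the event \<open>f \<le> b\<close>, of probability
  at least \<open>1 - e\<close>, the function \<open>s - t f\<close> is at least \<open>s - t b\<close>. Hahn--Banach then yields \<open>\<phi>\<close> with
  a density \<open>g\<close>, and \<open>B\<close> is the event \<open>g \<ge> 1/2\<close>: there \<open>f \<le> 2 g f\<close>, which bounds the integral
  of \<open>f\<close> by \<open>2 b\<close>; and \<open>1 - e \<le> \<phi> 1 \<le> P(B) + (1 - P(B)) / 2\<close> bounds \<open>P(B)\<close> from below.
\<close>

lemma (in prob_space) convex_bounded_in_probability_localization: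
  assumes bm: "C \<subseteq> bounded_measurable M" and "C \<noteq> {}"
    and convex: "\<And>f g t. f \<in> C \<Longrightarrow> g \<in> C \<Longrightarrow> 0 \<le> t \<Longrightarrow> t \<le> 1 \<Longrightarrow> (\<lambda>\<omega>. t * f \<omega> + (1 - t) * g \<omega>) \<in> C"
    and nonneg: "\<And>f. f \<in> C \<Longrightarrow> AE \<omega> in M. 0 \<le> f \<omega>"
    and tail: "\<And>f. f \<in> C \<Longrightarrow> measure M {\<omega>\<in>space M. b < f \<omega>} \<le> e" and b: "0 \<le> b"
  obtains B where "B \<in> sets M" "1 - 2 * e \<le> measure M B"
    "\<And>f. f \<in> C \<Longrightarrow> (\<integral>\<omega>. f \<omega> * indicator B \<omega> \<partial>M) \<le> 2 * b"
proof -
  let ?V = "bounded_measurable M"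
  note VD = bounded_measurable_closed[where M = M]
  obtain f0 where f0: "f0 \<in> C" using \<open>C \<noteq> {}\<close> by blast
  have e: "0 \<le> e" using tail[OF f0] measure_nonneg order_trans by blast
  define r where "r f = (\<integral>\<omega>. max 0 (f \<omega>) \<partial>M)" for f :: "'a \<Rightarrow> real"
  have r: "sublinear_on ?V r" unfolding r_def by (rule sublinear_on_integral_pos_part)
  have r_nonneg: "0 \<le> r f" for f
    unfolding r_def by (intro Bochner_Integration.integral_nonneg) simp
  define K where "K = {((\<lambda>\<omega>. t * f \<omega> - s), t * b - s * (1 - e)) | t s f. 0 \<le> t \<and> 0 \<le> s \<and> f \<in> C}"
  have KI: "(h, c) \<in> K"
    if "0 \<le> t" "0 \<le> s" "f \<in> C" "h = (\<lambda>\<omega>. t * f \<omega> - s)" "c = t * b - s * (1 - e)" for h c t s f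
    using that unfolding K_def by blast
  have K: "constraint_cone ?V K"
    unfolding constraint_cone_def
  proof (intro conjI allI impI)
    show "fst ` K \<subseteq> ?V" using bm by (auto simp: K_def intro!: VD(3,5))
    show "((\<lambda>_. 0), 0) \<in> K"
      by (rule KI[of 0 0 f0]) (use f0 in auto)
    fix g c h d assume "(g, c) \<in> K" "(h, d) \<in> K"
    then obtain t s f t' s' f' where *: "0 \<le> t" "0 \<le> s" "f \<in> C" "0 \<le> t'" "0 \<le> s'" "f' \<in> C"
      "g = (\<lambda>\<omega>. t * f \<omega> - s)" "c = t * b - s * (1 - e)"
      "h = (\<lambda>\<omega>. t' * f' \<omega> - s')" "d = t' * b - s' * (1 - e)"
      by (auto simp: K_def)
    \<comment> \<open>If \<open>t + t' = 0\<close>, division by zero gives \<open>u = 0\<close>, which is still a valid convex weight.\<close>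
    define u where "u = t / (t + t')"
    have u: "0 \<le> u" "u \<le> 1" "t = (t + t') * u" "t' = (t + t') * (1 - u)"
      using *(1,4) by (cases "t + t' = 0"; simp add: u_def divide_le_eq field_simps)+
    have "(\<lambda>\<omega>. u * f \<omega> + (1 - u) * f' \<omega>) \<in> C" using * u by (intro convex)
    moreover have "t * f \<omega> + t' * f' \<omega> = (t + t') * (u * f \<omega> + (1 - u) * f' \<omega>)" for \<omega>
      using u(3,4) by (metis distrib_left mult.assoc)
    ultimately show "((\<lambda>x. g x + h x), c + d) \<in> K"
      using *
      by (intro KI[of "t + t'" "s + s'" "\<lambda>\<omega>. u * f \<omega> + (1 - u) * f' \<omega>"])
        (simp_all, simp_all add: fun_eq_iff algebra_simps)
  next
    fix g c and a :: real assume "(g, c) \<in> K" "0 < a"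
    then obtain t s f where "0 \<le> t" "0 \<le> s" "f \<in> C" "g = (\<lambda>\<omega>. t * f \<omega> - s)"
      "c = t * b - s * (1 - e)" "0 < a"
      by (auto simp: K_def)
    then show "((\<lambda>x. a * g x), a * c) \<in> K"
      by (intro KI[of "a * t" "a * s" f]) (simp_all, simp_all add: algebra_simps)
  qed
  have consistent: "0 \<le> r (\<lambda>x. - g x) + c" if "(g, c) \<in> K" for g c
  proof -
    obtain t s f where *: "0 \<le> t" "0 \<le> s" "f \<in> C" "g = (\<lambda>\<omega>. t * f \<omega> - s)"
      "c = t * b - s * (1 - e)"
      using \<open>(g, c) \<in> K\<close> by (auto simp: K_def)
    have f: "f \<in> ?V" using * bm by blast
    then have [measurable]: "f \<in> borel_measurable M" by (simp add: bounded_measurable_def)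
    have gV: "g \<in> ?V" unfolding *(4) using f by (intro VD(3,5)) auto
    show ?thesis
    proof (cases "t * b \<le> s")
      case True
      define G where "G = {\<omega>\<in>space M. f \<omega> \<le> b}"
      have G[measurable]: "G \<in> sets M" unfolding G_def by measurable
      have "space M - G = {\<omega>\<in>space M. b < f \<omega>}" by (auto simp: G_def)
      then have "1 - e \<le> measure M G" using tail[OF *(3)] prob_compl[OF G] by simp
      then have "(s - t * b) * (1 - e) \<le> (s - t * b) * measure M G"
        using True by (intro mult_left_mono) auto
      also have "\<dots> = (\<integral>\<omega>. (s - t * b) * indicator G \<omega> \<partial>M)" by simp
      also have "\<dots> \<le> r (\<lambda>\<omega>. - g \<omega>)"
        unfolding r_def
      proof (rule integral_mono)
        show "integrable M (\<lambda>\<omega>. max 0 (- g \<omega>))"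
          using integrable_bounded_measurable[OF VD(4)[OF gV]] by simp
        show "(s - t * b) * indicator G \<omega> \<le> max 0 (- g \<omega>)" for \<omega>
          using * by (auto simp: G_def indicator_def intro!: max.coboundedI2 mult_left_mono)
      qed (simp add: integrable_bounded_measurable bounded_measurable_indicator)
      finally have "(s - t * b) * (1 - e) \<le> r (\<lambda>\<omega>. - g \<omega>)" .
      moreover have "(s - t * b) * (1 - e) + c = t * b * e" unfolding *(5) by (simp add: algebra_simps)
      moreover have "0 \<le> t * b * e" using *(1) b e by simp
      ultimately show ?thesis by linarith
    next
      case False
      have "s * (1 - e) \<le> s * 1" using * e by (intro mult_left_mono) auto
      then show ?thesis using False * r_nonneg[of "\<lambda>\<omega>. - g \<omega>"] by simp
    qed
  qed
  obtain \<phi> where \<phi>: "linear_functional_on ?V \<phi>" "\<And>f. f \<in> ?V \<Longrightarrow> \<phi> f \<le> r f"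
    "\<And>f c. (f, c) \<in> K \<Longrightarrow> \<phi> f \<le> c"
    using Hahn_Banach_constrained[OF function_space_bounded_measurable r K consistent] by blast
  have neg: "\<phi> (\<lambda>\<omega>. - f \<omega>) = - \<phi> f" if "f \<in> ?V" for f
    using \<phi>(1) that by (rule linear_functional_on_minus)
  have pos: "positive_functional M \<phi>"
    unfolding positive_functional_def
  proof (intro conjI ballI impI)
    fix f assume f: "f \<in> ?V" and "\<forall>x\<in>space M. 0 \<le> f x"
    then have "r (\<lambda>\<omega>. - f \<omega>) = (\<integral>\<omega>. 0 \<partial>M)"
      unfolding r_def by (intro Bochner_Integration.integral_cong) auto
    then show "0 \<le> \<phi> f" using neg[OF f] \<phi>(2)[OF VD(4)[OF f]] by simp
  qed fact
  have ind_le: "\<phi> (indicator A) \<le> measure M A" if A: "A \<in> sets M" for A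
  proof -
    have "(\<lambda>\<omega>. max 0 (indicator A \<omega>)) = (indicator A :: _ \<Rightarrow> real)" by (auto simp: indicator_def)
    then show ?thesis
      using \<phi>(2)[OF bounded_measurable_indicator[OF A]] A by (simp add: r_def)
  qed
  obtain g where g: "g \<in> borel_measurable M" "\<And>\<omega>. 0 \<le> g \<omega>"
    "\<And>f. f \<in> ?V \<Longrightarrow> integrable M (\<lambda>\<omega>. g \<omega> * f \<omega>)"
    "\<And>f. f \<in> ?V \<Longrightarrow> \<phi> f = (\<integral>\<omega>. g \<omega> * f \<omega> \<partial>M)"
    using dominated_positive_functional_density[OF pos ind_le] by blast
  note [measurable] = g(1)
  have \<phi>_C: "\<phi> f \<le> b" if "f \<in> C" for f
    by (rule \<phi>(3), rule KI[of 1 0 f]) (use that in auto)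
  have "((\<lambda>_. - 1), - (1 - e)) \<in> K"
    by (rule KI[of 0 1 f0]) (use f0 e in auto)
  then have one: "1 - e \<le> \<phi> (\<lambda>_. 1)" using \<phi>(3)[of "\<lambda>_. - 1"] neg[of "\<lambda>_. 1"] by fastforce
  define B where "B = {\<omega>\<in>space M. 1 / 2 \<le> g \<omega>}"
  have B[measurable]: "B \<in> sets M" unfolding B_def by measurable
  show ?thesis
  proof
    show "B \<in> sets M" by fact
    show "1 - 2 * e \<le> measure M B"
    proof -
      have "\<phi> (indicator (space M - B)) = (\<integral>\<omega>. g \<omega> * indicator (space M - B) \<omega> \<partial>M)"
        by (intro g(4) bounded_measurable_indicator) simp
      also have "\<dots> \<le> (\<integral>\<omega>. 1 / 2 * indicator (space M - B) \<omega> \<partial>M)"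
      proof (rule integral_mono)
        show "integrable M (\<lambda>\<omega>. g \<omega> * indicator (space M - B) \<omega>)"
          by (intro g(3) bounded_measurable_indicator) simp
        show "integrable M (\<lambda>\<omega>. 1 / 2 * indicat_real (space M - B) \<omega>)"
          by (intro integrable_bounded_measurable VD(3) bounded_measurable_indicator) simp
      qed (auto simp: B_def indicator_def)
      also have "\<dots> = (1 - measure M B) / 2" by (simp add: prob_compl)
      finally have c: "\<phi> (indicator (space M - B)) \<le> (1 - measure M B) / 2" .
      have "\<phi> (\<lambda>_. 1) \<le> \<phi> (\<lambda>\<omega>. indicator B \<omega> + indicator (space M - B) \<omega>)"
        by (intro positive_functional_mono[OF pos] VD bounded_measurable_indicator)
          (auto simp: indicator_def)
      also have "\<dots> = \<phi> (indicator B) + \<phi> (indicator (space M - B))"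
        by (intro positive_functionalD(1)[OF pos] bounded_measurable_indicator) auto
      finally show ?thesis using one c ind_le[OF B] by simp
    qed
    fix f assume f: "f \<in> C"
    have fV: "f \<in> ?V" using f bm by blast
    then have [measurable]: "f \<in> borel_measurable M" by (simp add: bounded_measurable_def)
    have "(\<integral>\<omega>. f \<omega> * indicator B \<omega> \<partial>M) \<le> (\<integral>\<omega>. 2 * (g \<omega> * f \<omega>) \<partial>M)"
    proof (rule integral_mono_AE)
      show "integrable M (\<lambda>\<omega>. f \<omega> * indicator B \<omega>)"
        by (rule integrable_real_mult_indicator[OF B integrable_bounded_measurable[OF fV]])
      show "integrable M (\<lambda>\<omega>. 2 * (g \<omega> * f \<omega>))" using g(3)[OF fV] by simp
      show "AE \<omega> in M. f \<omega> * indicator B \<omega> \<le> 2 * (g \<omega> * f \<omega>)"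
        using nonneg[OF f]
      proof eventually_elim
        case (elim \<omega>)
        have "1 * f \<omega> \<le> (2 * g \<omega>) * f \<omega>" if "\<omega> \<in> B"
          using elim that by (intro mult_right_mono) (auto simp: B_def)
        then show ?case using elim g(2)[of \<omega>] by (auto simp: indicator_def)
      qed
    qed
    then show "(\<integral>\<omega>. f \<omega> * indicator B \<omega> \<partial>M) \<le> 2 * b"
      using g(4)[OF fV] \<phi>_C[OF f] by simp
  qed
qed

text \<open>
  This is homogeneity: with \<open>c = ess sup (-X)\<close> positive, \<open>X / c \<ge> -1\<close>. For \<open>c \<le> 0\<close> every multiple of
  \<open>X\<close> is bounded below by \<open>-1\<close>, so the integral of \<open>X\<close> over \<open>A\<close> cannot be positive; as \<open>X \<ge> -c\<close> and
  \<open>A\<close> is not null, this leaves only \<open>c = 0\<close>.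
\<close>

lemma (in prob_space) unit_lower_bound_imp_dominated_by_esssup:
  assumes L: "rv_convex_cone L" and bm: "L \<subseteq> bounded_measurable M"
    and A: "A \<in> sets M" "0 < measure M A" and k: "0 \<le> k"
    and unit: "\<And>X. X \<in> L \<Longrightarrow> AE \<omega> in M. -1 \<le> X \<omega> \<Longrightarrow> (\<integral>\<omega>. X \<omega> * indicator A \<omega> \<partial>M) \<le> k"
    and X: "X \<in> L"
  shows "(\<integral>\<omega>. X \<omega> * indicator A \<omega> \<partial>M) \<le> k * real_esssup (\<lambda>\<omega>. - X \<omega>)"
proof -
  define c where "c = real_esssup (\<lambda>\<omega>. - X \<omega>)"
  define I where "I = (\<integral>\<omega>. X \<omega> * indicator A \<omega> \<partial>M)"
  have V: "X \<in> bounded_measurable M" using X bm by blast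
  have c: "AE \<omega> in M. - X \<omega> \<le> c"
    unfolding c_def by (rule real_esssup_AE[OF bounded_measurable_closed(4)[OF V]])
  have int: "integrable M (\<lambda>\<omega>. X \<omega> * indicator A \<omega>)"
    by (rule integrable_real_mult_indicator[OF A(1) integrable_bounded_measurable[OF V]])
  have scaled: "t * I \<le> k" if t: "0 \<le> t" "t * c \<le> 1" for t
  proof -
    have "AE \<omega> in M. -1 \<le> t * X \<omega>"
      using c
    proof eventually_elim
      case (elim \<omega>)
      then show ?case using mult_left_mono[OF elim t(1)] t(2) by simp
    qed
    then have "(\<integral>\<omega>. t * X \<omega> * indicator A \<omega> \<partial>M) \<le> k"
      by (intro unit rv_convex_coneD[OF L] X t)
    then show ?thesis by (simp add: I_def mult.assoc)
  qed
  have "I \<le> k * c"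
  proof (cases "0 < c")
    case True
    then show ?thesis using scaled[of "1 / c"] by (simp add: field_simps)
  next
    case False
    have "I \<le> 0"
    proof (rule ccontr)
      assume "\<not> I \<le> 0"
      moreover have "(k + 1) / I * c \<le> 1"
        using False k \<open>\<not> I \<le> 0\<close> by (intro order_trans[OF mult_nonneg_nonpos]) auto
      ultimately show False using scaled[of "(k + 1) / I"] k by simp
    qed
    have "(\<integral>\<omega>. - c * indicator A \<omega> \<partial>M) \<le> I"
      unfolding I_def
    proof (rule integral_mono_AE[OF _ int])
      show "integrable M (\<lambda>\<omega>. - c * indicat_real A \<omega>)"
        by (intro integrable_bounded_measurable bounded_measurable_closed
            bounded_measurable_indicator A)
      show "AE \<omega> in M. - c * indicator A \<omega> \<le> X \<omega> * indicator A \<omega>"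
        using c by eventually_elim (simp add: indicator_def)
    qed
    then have "- c * measure M A \<le> 0" using \<open>I \<le> 0\<close> A by simp
    then have "0 \<le> c" using A(2) by (simp add: zero_le_mult_iff)
    then show ?thesis using False \<open>I \<le> 0\<close> by simp
  qed
  then show ?thesis by (simp add: I_def c_def)
qed

text \<open>
  The functions \<open>1 + X\<close> with \<open>X \<in> L\<close> and \<open>X \<ge> -1\<close> form a convex set of nonnegative functions that is
  bounded in probability. On the event found for this set their integrals are bounded, and the
  conic structure of \<open>L\<close> turns the bound into one by the essential supremum.
\<close>

lemma (in prob_space) bounded_in_probability_imp_localized_domination:
  assumes L: "rv_convex_cone L" "L \<noteq> {}" and bm: "L \<subseteq> bounded_measurable M"
    and e: "e < 1 / 2" and b: "0 \<le> b"
    and tail: "\<And>X. X \<in> L \<Longrightarrow> AE \<omega> in M. -1 \<le> X \<omega> \<Longrightarrow>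
      measure M {\<omega>\<in>space M. b < X \<omega>} \<le> e"
  obtains A k where "A \<in> sets M" "1 - 2 * e \<le> measure M A" "0 \<le> k"
    "\<And>X. X \<in> L \<Longrightarrow> (\<integral>\<omega>. X \<omega> * indicator A \<omega> \<partial>M) \<le> k * real_esssup (\<lambda>\<omega>. - X \<omega>)"
proof -
  define C where "C = {(\<lambda>\<omega>. X \<omega> + 1) | X. X \<in> L \<and> (AE \<omega> in M. -1 \<le> X \<omega>)}"
  have C_bm: "C \<subseteq> bounded_measurable M"
    using bm by (auto simp: C_def intro!: bounded_measurable_closed)
  have C_ne: "C \<noteq> {}" using rv_convex_coneD(3)[OF L] by (auto simp: C_def intro!: exI[of _ "\<lambda>_. 0"])
  have C_convex: "(\<lambda>\<omega>. t * f \<omega> + (1 - t) * g \<omega>) \<in> C"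
    if fg: "f \<in> C" "g \<in> C" and t: "0 \<le> t" "t \<le> 1" for f g t
  proof -
    obtain X Y where XY: "X \<in> L" "AE \<omega> in M. -1 \<le> X \<omega>" "f = (\<lambda>\<omega>. X \<omega> + 1)"
      "Y \<in> L" "AE \<omega> in M. -1 \<le> Y \<omega>" "g = (\<lambda>\<omega>. Y \<omega> + 1)"
      using fg by (auto simp: C_def)
    have "(\<lambda>\<omega>. t * X \<omega> + (1 - t) * Y \<omega>) \<in> L"
      using XY t by (intro rv_convex_cone_combination[OF L(1)]) auto
    moreover have "AE \<omega> in M. -1 \<le> t * X \<omega> + (1 - t) * Y \<omega>"
      using XY(2,5)
    proof eventually_elim
      case (elim \<omega>)
      have "t * -1 + (1 - t) * -1 \<le> t * X \<omega> + (1 - t) * Y \<omega>"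
        using elim t by (intro add_mono mult_left_mono) auto
      then show ?case by simp
    qed
    ultimately show ?thesis
      unfolding C_def XY(3,6)
      by (intro CollectI exI[of _ "\<lambda>\<omega>. t * X \<omega> + (1 - t) * Y \<omega>"]) (simp add: algebra_simps)
  qed
  obtain A where A: "A \<in> sets M" "1 - 2 * e \<le> measure M A"
    "\<And>f. f \<in> C \<Longrightarrow> (\<integral>\<omega>. f \<omega> * indicator A \<omega> \<partial>M) \<le> 2 * (b + 1)"
  proof (rule convex_bounded_in_probability_localization[OF C_bm C_ne C_convex])
    show "AE \<omega> in M. 0 \<le> f \<omega>" if "f \<in> C" for f
      using that by (auto simp: C_def elim!: eventually_mono)
    show "measure M {\<omega>\<in>space M. b + 1 < f \<omega>} \<le> e" if "f \<in> C" for f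
      using that tail by (auto simp: C_def)
  qed (use b in auto)
  show ?thesis
  proof
    show "0 \<le> 2 * (b + 1)" using b by simp
    fix X assume "X \<in> L"
    then show "(\<integral>\<omega>. X \<omega> * indicator A \<omega> \<partial>M) \<le> 2 * (b + 1) * real_esssup (\<lambda>\<omega>. - X \<omega>)"
    proof (rule unit_lower_bound_imp_dominated_by_esssup[OF L(1) bm A(1), rotated 3])
      show "0 < measure M A" using A(2) e by simp
      show "0 \<le> 2 * (b + 1)" using b by simp
      fix Y assume Y: "Y \<in> L" "AE \<omega> in M. -1 \<le> Y \<omega>"
      have YV: "Y \<in> bounded_measurable M" using Y bm by blast
      have "(\<integral>\<omega>. Y \<omega> * indicator A \<omega> \<partial>M) \<le> (\<integral>\<omega>. (Y \<omega> + 1) * indicator A \<omega> \<partial>M)"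
        using YV A(1)
        by (intro integral_mono integrable_real_mult_indicator integrable_bounded_measurable
            bounded_measurable_closed) (auto simp: indicator_def)
      also have "\<dots> \<le> 2 * (b + 1)" using Y by (intro A(3)) (auto simp: C_def)
      finally show "(\<integral>\<omega>. Y \<omega> * indicator A \<omega> \<partial>M) \<le> 2 * (b + 1)" .
    qed
  qed (use A in auto)
qed

section \<open>Patching the local dominations together\<close>

text \<open>
  The density is normalized by its total mass \<open>z\<close>; it is positive almost surely, so no event
  loses its mass.
\<close>

lemma (in prob_space) density_equiv_prob:
  fixes w :: "'a \<Rightarrow> real"
  assumes w: "integrable M w" "\<And>\<omega>. 0 \<le> w \<omega>" and pos: "AE \<omega> in M. 0 < w \<omega>"
  obtains Q z where "Q \<in> equiv_probs M" "0 < z"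
    "\<And>X. X \<in> borel_measurable M \<Longrightarrow> (\<integral>\<omega>. X \<omega> \<partial>Q) = (\<integral>\<omega>. w \<omega> * X \<omega> \<partial>M) / z"
proof
  define z where "z = (\<integral>\<omega>. w \<omega> \<partial>M)"
  have [measurable]: "w \<in> borel_measurable M" using w(1) by simp
  have "z \<noteq> 0"
  proof
    assume "z = 0"
    then have "AE \<omega> in M. w \<omega> = 0"
      using w integral_nonneg_eq_0_iff_AE[OF w(1)] by (simp add: z_def)
    then have "AE \<omega> in M. False" using pos by eventually_elim simp
    then show False by simp
  qed
  moreover have "0 \<le> z" unfolding z_def using w(2) by (intro integral_nonneg_AE AE_I2)
  ultimately show z: "0 < z" by simp
  define Q where "Q = density M (\<lambda>\<omega>. ennreal (w \<omega> / z))"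
  show "(\<integral>\<omega>. X \<omega> \<partial>Q) = (\<integral>\<omega>. w \<omega> * X \<omega> \<partial>M) / z" if [measurable]: "X \<in> borel_measurable M" for X
  proof -
    have "(\<integral>\<omega>. X \<omega> \<partial>Q) = (\<integral>\<omega>. (w \<omega> / z) * X \<omega> \<partial>M)"
      unfolding Q_def using z w(2) by (subst integral_density) (auto intro!: AE_I2)
    then show ?thesis by simp
  qed
  have "(\<integral>\<^sup>+\<omega>. ennreal (w \<omega> / z) \<partial>M) = ennreal (\<integral>\<omega>. w \<omega> / z \<partial>M)"
    using z w by (intro nn_integral_eq_integral) (auto intro!: AE_I2)
  also have "(\<integral>\<omega>. w \<omega> / z \<partial>M) = 1" using z by (simp add: z_def)
  finally have total: "(\<integral>\<^sup>+\<omega>. ennreal (w \<omega> / z) \<partial>M) = 1" by simp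
  have "prob_space Q"
    by (rule prob_spaceI) (simp add: Q_def emeasure_density total cong: nn_integral_cong)
  then interpret Q: prob_space Q .
  have "measure Q A = 0 \<longleftrightarrow> measure M A = 0" if A: "A \<in> sets M" for A
  proof -
    have "measure Q A = 0 \<longleftrightarrow> A \<in> null_sets Q"
      using A Q.emeasure_eq_measure[of A] by (simp add: null_sets_def Q_def)
    also have "\<dots> \<longleftrightarrow> (AE \<omega> in M. \<omega> \<in> A \<longrightarrow> ennreal (w \<omega> / z) = 0)"
      unfolding Q_def using A by (subst null_sets_density_iff) auto
    also have "\<dots> \<longleftrightarrow> (AE \<omega> in M. \<omega> \<notin> A)"
    proof
      assume "AE \<omega> in M. \<omega> \<in> A \<longrightarrow> ennreal (w \<omega> / z) = 0"
      then show "AE \<omega> in M. \<omega> \<notin> A"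
        using pos by eventually_elim (use z in \<open>auto simp: ennreal_eq_0_iff divide_le_0_iff\<close>)
    qed auto
    also have "\<dots> \<longleftrightarrow> measure M A = 0" using A by (simp add: prob_eq_0)
    finally show ?thesis .
  qed
  then show "Q \<in> equiv_probs M"
    using Q.prob_space_axioms by (auto simp: equiv_probs_def fa_equiv_def fa_abs_cont_def Q_def)
qed

text \<open>
  The density is proportional to \<open>w = (\<Sum>n. a n * indicator (A n))\<close> with weights
  \<open>a n = 2\<^sup>-\<^sup>n / (1 + k n)\<close>, chosen so that both \<open>a n\<close> and \<open>a n * k n\<close> are summable. It is positive
  almost surely since the \<open>A n\<close> exhaust the space. The quantity \<open>c X\<close> stands for the
  essential supremum of \<open>-X\<close>.
\<close>

lemma (in prob_space) localized_domination_imp_dominated_by_esssup: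
  fixes L :: "('a \<Rightarrow> real) set" and c :: "('a \<Rightarrow> real) \<Rightarrow> real"
  assumes bm: "L \<subseteq> bounded_measurable M"
    and A: "\<And>n. A n \<in> sets M" and k: "\<And>n. 0 \<le> k n"
    and lim: "(\<lambda>n. measure M (A n)) \<longlonglongrightarrow> 1"
    and le: "\<And>n X. X \<in> L \<Longrightarrow> (\<integral>\<omega>. X \<omega> * indicator (A n) \<omega> \<partial>M) \<le> k n * c X"
  shows "\<exists>Q\<in>equiv_probs M. \<exists>k\<ge>0. \<forall>X\<in>L. (\<integral>\<omega>. X \<omega> \<partial>Q) \<le> k * c X"
proof -
  define a where "a n = (1 / 2) ^ n / (1 + k n)" for n
  have geo: "summable (\<lambda>n. (1 / 2 :: real) ^ n)" by (intro summable_geometric) simp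
  have a_pos: "0 < a n" and a_le: "a n \<le> (1 / 2) ^ n" and ak_le: "a n * k n \<le> (1 / 2) ^ n" for n
  proof -
    have "0 < 1 + k n" using k[of n] by simp
    then show "0 < a n" "a n \<le> (1 / 2) ^ n" "a n * k n \<le> (1 / 2) ^ n"
      using k[of n] by (auto simp: a_def divide_le_eq mult_le_cancel_left1)
  qed
  have a_sum: "summable a" and ak_sum: "summable (\<lambda>n. a n * k n)"
    using a_le ak_le a_pos k
    by (auto intro!: summable_comparison_test'[OF geo, of 0] simp: less_imp_le abs_mult)
  define w where "w \<omega> = (\<Sum>n. a n * indicator (A n) \<omega>)" for \<omega>
  have aI_sum: "summable (\<lambda>n. a n * indicator (A n) \<omega>)" for \<omega>
    using a_pos
    by (intro summable_comparison_test'[OF a_sum, of 0]) (auto simp: indicator_def less_imp_le)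
  have w_nonneg: "0 \<le> w \<omega>" for \<omega>
    unfolding w_def using a_pos by (intro suminf_nonneg aI_sum) (auto simp: less_imp_le)
  have series: "(\<lambda>n. a n * (\<integral>\<omega>. X \<omega> * indicator (A n) \<omega> \<partial>M)) sums (\<integral>\<omega>. w \<omega> * X \<omega> \<partial>M)
      \<and> integrable M (\<lambda>\<omega>. w \<omega> * X \<omega>)"
    if X: "X \<in> bounded_measurable M" for X
  proof -
    obtain b where b: "X \<in> borel_measurable M" "\<And>\<omega>. \<omega> \<in> space M \<Longrightarrow> \<bar>X \<omega>\<bar> \<le> b"
      using X by (auto simp: bounded_measurable_iff)
    have b0: "0 \<le> b" using b(2) not_empty by (metis abs_ge_zero all_not_in_conv order_trans)
    let ?f = "\<lambda>n \<omega>. a n * (X \<omega> * indicator (A n) \<omega>)"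
    have le_ab: "norm (?f n \<omega>) \<le> a n * b" if "\<omega> \<in> space M" for n \<omega>
      using b(2)[OF that] a_pos[of n] b0 by (auto simp: abs_mult indicator_def)
    have f_int: "integrable M (?f n)" for n
      by (rule integrable_const_bound[where B = "a n * b"])
        (use A b(1) le_ab in \<open>auto intro!: AE_I2\<close>)
    have pt: "summable (\<lambda>n. norm (?f n \<omega>))" if "\<omega> \<in> space M" for \<omega>
      by (rule summable_comparison_test'[OF summable_mult2[OF a_sum, of b], of 0])
        (use le_ab[OF that] in simp)
    have "(\<integral>\<omega>. norm (?f n \<omega>) \<partial>M) \<le> a n * b" for n
    proof -
      have "(\<integral>\<omega>. norm (?f n \<omega>) \<partial>M) \<le> (\<integral>\<omega>. a n * b \<partial>M)"
        by (rule integral_mono) (use f_int le_ab in auto)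
      then show ?thesis by (simp add: prob_space)
    qed
    then have sm: "summable (\<lambda>n. \<integral>\<omega>. norm (?f n \<omega>) \<partial>M)"
      by (intro summable_comparison_test'[OF summable_mult2[OF a_sum, of b], of 0]) simp
    note s = integrable_suminf[OF f_int AE_I2 sm, OF pt]
      sums_integral[OF f_int AE_I2 sm, OF pt]
    have "w \<omega> * X \<omega> = (\<Sum>n. ?f n \<omega>)" for \<omega>
      unfolding w_def by (subst suminf_mult2[OF aI_sum]) (simp add: ac_simps)
    then show ?thesis using s by simp
  qed
  have "AE \<omega> in M. \<omega> \<in> (\<Union>n. A n)"
  proof -
    have "measure M (A n) \<le> measure M (\<Union>n. A n)" for n
      using A by (intro finite_measure_mono) auto
    then have "1 \<le> measure M (\<Union>n. A n)" by (intro LIMSEQ_le_const2[OF lim]) auto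
    then have "measure M (\<Union>n. A n) = 1" using prob_le_1 by (simp add: antisym)
    then show ?thesis by (rule AE_prob_1)
  qed
  then have "AE \<omega> in M. 0 < w \<omega>"
  proof eventually_elim
    case (elim \<omega>)
    then obtain n where "\<omega> \<in> A n" by blast
    then show ?case unfolding w_def using a_pos
      by (intro suminf_pos2[where i = n] aI_sum) (auto simp: less_imp_le)
  qed
  moreover have "integrable M w" using series[of "\<lambda>_. 1"] by simp
  ultimately obtain Q z where Q: "Q \<in> equiv_probs M" "0 < z"
    "\<And>X. X \<in> borel_measurable M \<Longrightarrow> (\<integral>\<omega>. X \<omega> \<partial>Q) = (\<integral>\<omega>. w \<omega> * X \<omega> \<partial>M) / z"
    using density_equiv_prob w_nonneg by blast
  define K where "K = (\<Sum>n. a n * k n) / z"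
  have "0 \<le> K"
    unfolding K_def using Q(2) a_pos k
    by (intro divide_nonneg_pos suminf_nonneg ak_sum) (auto simp: less_imp_le)
  moreover have "(\<integral>\<omega>. X \<omega> \<partial>Q) \<le> K * c X" if X: "X \<in> L" for X
  proof -
    have XV: "X \<in> bounded_measurable M" using X bm by blast
    have "(\<integral>\<omega>. w \<omega> * X \<omega> \<partial>M) \<le> (\<Sum>n. a n * k n * c X)"
    proof (rule sums_le)
      show "(\<lambda>n. a n * (\<integral>\<omega>. X \<omega> * indicator (A n) \<omega> \<partial>M)) sums (\<integral>\<omega>. w \<omega> * X \<omega> \<partial>M)"
        using series[OF XV] by simp
      show "(\<lambda>n. a n * k n * c X) sums (\<Sum>n. a n * k n * c X)"
        by (intro summable_sums summable_mult2 ak_sum)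
      show "a n * (\<integral>\<omega>. X \<omega> * indicator (A n) \<omega> \<partial>M) \<le> a n * k n * c X" for n
        using mult_left_mono[OF le[OF X, of n], of "a n"] a_pos[of n] by simp
    qed
    also have "\<dots> = K * z * c X" using Q(2) by (simp add: K_def suminf_mult2[OF ak_sum, symmetric, of "c X"])
    finally show ?thesis
      using Q(2) Q(3)[of X] XV by (simp add: bounded_measurable_iff divide_le_eq ac_simps)
  qed
  ultimately show ?thesis using Q(1) by blast
qed

section \<open>Super-martingale probabilities from domination\<close>

text \<open>
  The constraints on the functional \<open>\<phi>\<close> are \<open>\<phi> (k X) \<le> - E\<^sub>Q X\<close>. In this form, not divided by \<open>k\<close>,
  they cover \<open>k = 0\<close> as well. They are consistent with the essential supremum by hypothesis. From
  \<open>\<phi> \<le> ess sup\<close> follow positivity, \<open>\<phi> 1 = 1\<close>, and the vanishing of \<open>\<phi>\<close> on null sets, so the mixture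
  is equivalent to \<open>M\<close> because \<open>Q\<close> is.
\<close>

lemma (in prob_space) dominated_by_esssup_imp_ESFA:
  assumes L: "rv_convex_cone L" "L \<noteq> {}" and bm: "L \<subseteq> bounded_measurable M"
    and Q: "Q \<in> equiv_probs M" and k: "0 \<le> k"
    and le: "\<And>X. X \<in> L \<Longrightarrow>
      ereal (\<integral>\<omega>. X \<omega> \<partial>Q) \<le> ereal k * esssup M (\<lambda>\<omega>. ereal (- X \<omega>))"
  shows "\<exists>P1. fa_prob M P1 \<and> (\<lambda>B. (measure Q B + k * P1 B) / (1 + k)) \<in> ESFA M L"
proof -
  let ?V = "bounded_measurable M"
  let ?I = "\<lambda>f. \<integral>\<omega>. f \<omega> \<partial>Q"
  note VD = bounded_measurable_closed[where M = M]
  have Q': "prob_space Q" "sets Q = sets M"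
    and Qequiv: "\<And>A. A \<in> sets M \<Longrightarrow> measure Q A = 0 \<longleftrightarrow> measure M A = 0"
    using Q by (auto simp: equiv_probs_def fa_equiv_def fa_abs_cont_def)
  interpret Q: prob_space Q by fact
  have I: "positive_functional M ?I"
    using Q' by (intro positive_functional_integral) unfold_locales
  define K where "K = {((\<lambda>\<omega>. k * X \<omega>), - ?I X) | X. X \<in> L}"
  have K: "constraint_cone ?V K"
    unfolding constraint_cone_def
  proof (intro conjI allI impI)
    show "fst ` K \<subseteq> ?V" using bm VD(3) by (auto simp: K_def)
    show "((\<lambda>_. 0), 0) \<in> K"
      using rv_convex_coneD(3)[OF L] by (auto simp: K_def intro!: exI[of _ "\<lambda>_. 0"])
    fix g c h d assume "(g, c) \<in> K" "(h, d) \<in> K"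
    then obtain X Y where XY: "X \<in> L" "Y \<in> L" "g = (\<lambda>\<omega>. k * X \<omega>)" "c = - ?I X"
      "h = (\<lambda>\<omega>. k * Y \<omega>)" "d = - ?I Y"
      by (auto simp: K_def)
    have "?I (\<lambda>\<omega>. X \<omega> + Y \<omega>) = ?I X + ?I Y"
      using XY bm by (intro positive_functionalD(1)[OF I]) auto
    then show "((\<lambda>x. g x + h x), c + d) \<in> K"
      unfolding K_def using XY rv_convex_coneD(1)[OF L(1)]
      by (intro CollectI exI[of _ "\<lambda>\<omega>. X \<omega> + Y \<omega>"]) (auto simp: algebra_simps)
  next
    fix g c and s :: real assume "(g, c) \<in> K" "0 < s"
    then obtain X where X: "X \<in> L" "g = (\<lambda>\<omega>. k * X \<omega>)" "c = - ?I X" "0 < s"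
      by (auto simp: K_def)
    then show "((\<lambda>x. s * g x), s * c) \<in> K"
      unfolding K_def using rv_convex_coneD(2)[OF L(1)]
      by (intro CollectI exI[of _ "\<lambda>\<omega>. s * X \<omega>"]) (auto simp: algebra_simps)
  qed
  have consistent: "0 \<le> real_esssup (\<lambda>x. - g x) + c" if "(g, c) \<in> K" for g c
  proof -
    obtain X where X: "X \<in> L" "g = (\<lambda>\<omega>. k * X \<omega>)" "c = - ?I X"
      using \<open>(g, c) \<in> K\<close> by (auto simp: K_def)
    have V: "(\<lambda>\<omega>. - X \<omega>) \<in> ?V" using X bm VD(4) by blast
    have "real_esssup (\<lambda>x. k * - X x) = k * real_esssup (\<lambda>x. - X x)"
      by (rule sublinear_on_scale[OF function_space_bounded_measurable sublinear_on_real_esssup V k])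
    then show ?thesis using le[OF X(1)] esssup_eq_real_esssup[OF V] by (simp add: X)
  qed
  obtain \<phi> where \<phi>: "linear_functional_on ?V \<phi>" "\<And>f. f \<in> ?V \<Longrightarrow> \<phi> f \<le> real_esssup f"
    "\<And>f c. (f, c) \<in> K \<Longrightarrow> \<phi> f \<le> c"
    using Hahn_Banach_constrained[OF function_space_bounded_measurable sublinear_on_real_esssup
        K consistent] by blast
  have \<phi>_le: "\<phi> f \<le> c" if "f \<in> ?V" "AE \<omega> in M. f \<omega> \<le> c" for f c
    using \<phi>(2)[OF that(1)] real_esssup_leI[OF that] by simp
  have neg: "\<phi> (\<lambda>\<omega>. - f \<omega>) = - \<phi> f" if "f \<in> ?V" for f
    using \<phi>(1) that by (rule linear_functional_on_minus)
  have pos: "positive_functional M \<phi>"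
    unfolding positive_functional_def
  proof (intro conjI ballI impI)
    fix f assume f: "f \<in> ?V" and "\<forall>x\<in>space M. 0 \<le> f x"
    then show "0 \<le> \<phi> f" using neg[OF f] \<phi>_le[OF VD(4)[OF f], of 0] by auto
  qed fact
  have one: "\<phi> (\<lambda>_. 1) = 1"
    using \<phi>_le[of "\<lambda>_. 1" 1] \<phi>_le[of "\<lambda>_. - 1" "- 1"] neg[of "\<lambda>_. 1"] by simp
  define P1 where "P1 A = \<phi> (indicator A)" for A
  define P where "P B = (measure Q B + k * P1 B) / (1 + k)" for B
  define \<psi> where "\<psi> f = (?I f + k * \<phi> f) / (1 + k)" for f
  have P1: "fa_prob M P1"
    by (rule positive_functional_fa_prob[OF pos one]) (simp add: P1_def)
  have \<psi>: "positive_functional M \<psi>"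
    using I pos k unfolding positive_functional_def linear_functional_on_def \<psi>_def
    by (auto simp: add_divide_distrib algebra_simps)
  have P_eq: "P A = \<psi> (indicator A)" if "A \<in> sets M" for A
    using that Q'(2) sets.sets_into_space[OF that] sets_eq_imp_space_eq[OF Q'(2)]
    by (simp add: P_def \<psi>_def P1_def Int_absorb2)
  have P: "fa_prob M P"
    using k one by (intro positive_functional_fa_prob[OF \<psi> _ P_eq]) (auto simp: \<psi>_def Q.prob_space)
  have P1_nonneg: "0 \<le> P1 A" if "A \<in> sets M" for A
    using P1 that by (auto simp: fa_prob_def)
  have P1_null: "P1 A = 0" if A: "A \<in> sets M" "measure M A = 0" for A
  proof -
    have "AE \<omega> in M. \<omega> \<notin> A" using A by (simp add: prob_eq_0)
    then have "AE \<omega> in M. indicator A \<omega> \<le> (0::real)" by eventually_elim simp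
    then have "P1 A \<le> 0" unfolding P1_def using A by (intro \<phi>_le bounded_measurable_indicator)
    then show ?thesis using P1_nonneg A by force
  qed
  have "fa_equiv M P (measure M)"
    unfolding fa_equiv_def fa_abs_cont_def
  proof (intro conjI ballI impI)
    fix A assume A: "A \<in> sets M" "measure M A = 0"
    then show "P A = 0" using P1_null Qequiv by (simp add: P_def)
  next
    fix A assume A: "A \<in> sets M" "P A = 0"
    then have "measure Q A + k * P1 A = 0" using k by (simp add: P_def)
    moreover have "0 \<le> k * P1 A" using k P1_nonneg A by simp
    ultimately have "measure Q A = 0" using measure_nonneg[of Q A] by linarith
    then show "measure M A = 0" using Qequiv A by simp
  qed
  moreover have "fa_integral M P X \<le> 0" if X: "X \<in> L" for X
  proof -
    have XV: "X \<in> ?V" using X bm by blast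
    have "fa_integral M P X = \<psi> X"
      by (intro fa_integral_eqI P positive_functional_has_fa_integral[OF prob_space_axioms \<psi> P_eq] XV)
    moreover have "k * \<phi> X \<le> - ?I X"
      using \<phi>(3)[of "\<lambda>\<omega>. k * X \<omega>" "- ?I X"] X positive_functionalD(2)[OF pos XV, of k]
      by (auto simp: K_def)
    ultimately show ?thesis using k by (simp add: \<psi>_def divide_le_0_iff)
  qed
  ultimately have "P \<in> ESFA M L" using P by (simp add: ESFA_def)
  then show ?thesis using P1 unfolding P_def by blast
qed

section \<open>The equivalences\<close>

theorem theorem2:
  fixes M :: "'a measure" and L :: "('a \<Rightarrow> real) set"
  assumes "prob_space M"
    and "L \<noteq> {}"
    and "rv_convex_cone L"
    and "\<And>X. X \<in> L \<Longrightarrow> X \<in> borel_measurable M"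
    and "\<And>X. X \<in> L \<Longrightarrow> bounded (X ` space M)"
  shows
    "(ESFA M L \<noteq> {} \<longleftrightarrow>
        Linfty_closure M (Linfty_minus_pos M L) \<inter> Linfty_pos M = Linfty_zero M)
   \<and> (ESFA M L \<noteq> {} \<longleftrightarrow>
        (\<exists>Q\<in>equiv_probs M. \<exists>k::real. k \<ge> 0 \<and>
           (\<forall>X\<in>L. ereal (\<integral>\<omega>. X \<omega> \<partial>Q) \<le> ereal k * esssup M (\<lambda>\<omega>. ereal (- X \<omega>)))))
   \<and> (ESFA M L \<noteq> {} \<longleftrightarrow>
        (\<exists>(A :: nat \<Rightarrow> 'a set) (k :: nat \<Rightarrow> real).
           (\<forall>n\<ge>1. A n \<in> sets M \<and> k n \<ge> 0) \<and>
           (\<lambda>n. measure M (A n)) \<longlonglongrightarrow> 1 \<and>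
           (\<forall>n\<ge>1. \<forall>X\<in>L. ereal (\<integral>\<omega>. X \<omega> * indicator (A n) \<omega> \<partial>M)
                          \<le> ereal (k n) * esssup M (\<lambda>\<omega>. ereal (- X \<omega>)))))
   \<and> (ESFA M L \<noteq> {} \<longleftrightarrow>
        tight_laws {distr M borel X | X. X \<in> L \<and> (AE \<omega> in M. X \<omega> \<ge> -1)})
   \<and> (\<forall>Q\<in>equiv_probs M. \<forall>k::real. k \<ge> 0 \<and>
        (\<forall>X\<in>L. ereal (\<integral>\<omega>. X \<omega> \<partial>Q) \<le> ereal k * esssup M (\<lambda>\<omega>. ereal (- X \<omega>)))
        \<longrightarrow> (\<exists>P1. fa_prob M P1 \<and> (\<lambda>B. (measure Q B + k * P1 B) / (1 + k)) \<in> ESFA M L))"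
    (is "(?S \<longleftrightarrow> ?a) \<and> (?S \<longleftrightarrow> ?b) \<and> (?S \<longleftrightarrow> ?c) \<and> (?S \<longleftrightarrow> ?d) \<and> ?mix")
proof -
  interpret prob_space M by fact
  have bm: "L \<subseteq> bounded_measurable M" using assms(4,5) by (auto simp: bounded_measurable_def)
  have meas: "L \<subseteq> borel_measurable M" using assms(4) by blast
  have esssup: "ereal x \<le> ereal k * esssup M (\<lambda>\<omega>. ereal (- X \<omega>))
      \<longleftrightarrow> x \<le> k * real_esssup (\<lambda>\<omega>. - X \<omega>)" if "X \<in> L" for x k X
    using that bm by (simp add: subset_iff bounded_measurable_closed(4) esssup_eq_real_esssup)
  have mix: ?mix
    using dominated_by_esssup_imp_ESFA[OF assms(3,2) bm] by blast
  have Sa: "?S \<Longrightarrow> ?a"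
    using ESFA_imp_closure_trivial[OF assms(3,2) bm] by blast
  have ad: ?d if ?a
  proof (rule bounded_in_probability_imp_tight_laws[OF meas])
    fix e :: real assume "0 < e"
    then show "\<exists>b. \<forall>X\<in>L. (AE \<omega> in M. -1 \<le> X \<omega>) \<longrightarrow> measure M {\<omega>\<in>space M. b < X \<omega>} < e"
      using closure_trivial_imp_bounded_in_probability[OF assms(3,2) bm \<open>?a\<close>] by metis
  qed
  have dc: ?c if ?d
  proof -
    define localizes where "localizes n A k \<longleftrightarrow> A \<in> sets M \<and> 1 - 1 / real (Suc n) \<le> measure M A \<and>
        0 \<le> k \<and> (\<forall>X\<in>L. (\<integral>\<omega>. X \<omega> * indicator A \<omega> \<partial>M) \<le> k * real_esssup (\<lambda>\<omega>. - X \<omega>))"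
      for n A k
    have "\<exists>A k. localizes n A k" if n: "1 \<le> n" for n
    proof -
      \<comment> \<open>Half of \<open>1/(n+1)\<close>, since the event may miss probability \<open>2 e\<close>.\<close>
      define e where "e = 1 / (2 * real (Suc n))"
      have e: "0 < e" "e < 1 / 2" "2 * e = 1 / real (Suc n)" using n by (auto simp: e_def field_simps)
      obtain b where b: "0 \<le> b"
        "\<And>X. X \<in> L \<Longrightarrow> AE \<omega> in M. -1 \<le> X \<omega> \<Longrightarrow> measure M {\<omega>\<in>space M. b < X \<omega>} \<le> e"
        using tight_laws_imp_bounded_in_probability[OF meas \<open>?d\<close> e(1)] by blast
      obtain A k where "A \<in> sets M" "1 - 2 * e \<le> measure M A" "0 \<le> k"
        "\<And>X. X \<in> L \<Longrightarrow> (\<integral>\<omega>. X \<omega> * indicator A \<omega> \<partial>M) \<le> k * real_esssup (\<lambda>\<omega>. - X \<omega>)"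
        using bounded_in_probability_imp_localized_domination[OF assms(3,2) bm e(2) b] by blast
      then show ?thesis unfolding e(3) localizes_def by blast
    qed
    then obtain A k where "\<And>n. 1 \<le> n \<Longrightarrow> localizes n (A n) (k n)" by metis
    then have Ak: "\<And>n. 1 \<le> n \<Longrightarrow> A n \<in> sets M"
      "\<And>n. 1 \<le> n \<Longrightarrow> 1 - 1 / real (Suc n) \<le> measure M (A n)" "\<And>n. 1 \<le> n \<Longrightarrow> 0 \<le> k n"
      "\<And>n X. 1 \<le> n \<Longrightarrow> X \<in> L \<Longrightarrow>
        (\<integral>\<omega>. X \<omega> * indicator (A n) \<omega> \<partial>M) \<le> k n * real_esssup (\<lambda>\<omega>. - X \<omega>)"
      unfolding localizes_def by blast+
    have "(\<lambda>n. measure M (A n)) \<longlonglongrightarrow> 1"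
    proof (rule tendsto_sandwich[OF _ _ _ tendsto_const])
      show "\<forall>\<^sub>F n in sequentially. 1 - 1 / real (Suc n) \<le> measure M (A n)"
        using Ak(2) by (auto simp: eventually_sequentially)
      have "(\<lambda>n. 1 - 1 / real (Suc n)) \<longlonglongrightarrow> 1 - 0"
        using LIMSEQ_inverse_real_of_nat by (intro tendsto_diff) (simp_all add: inverse_eq_divide)
      then show "(\<lambda>n. 1 - 1 / real (Suc n)) \<longlonglongrightarrow> 1" by simp
    qed simp
    then show ?c using Ak esssup by (intro exI[of _ A] exI[of _ k]) simp
  qed
  have cb: ?b if ?c
  proof -
    from \<open>?c\<close> obtain A k where Ak: "\<forall>n\<ge>1. A n \<in> sets M \<and> 0 \<le> k n"
      "(\<lambda>n. measure M (A n)) \<longlonglongrightarrow> 1"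
      and "\<forall>n\<ge>1. \<forall>X\<in>L. ereal (\<integral>\<omega>. X \<omega> * indicator (A n) \<omega> \<partial>M)
        \<le> ereal (k n) * esssup M (\<lambda>\<omega>. ereal (- X \<omega>))"
      by blast
    then have le: "\<forall>n\<ge>1. \<forall>X\<in>L. (\<integral>\<omega>. X \<omega> * indicator (A n) \<omega> \<partial>M)
        \<le> k n * real_esssup (\<lambda>\<omega>. - X \<omega>)"
      using esssup by simp
    have "\<exists>Q\<in>equiv_probs M. \<exists>k\<ge>0. \<forall>X\<in>L. (\<integral>\<omega>. X \<omega> \<partial>Q) \<le> k * real_esssup (\<lambda>\<omega>. - X \<omega>)"
      using Ak(1) le LIMSEQ_Suc[OF Ak(2)]
      by (intro localized_domination_imp_dominated_by_esssup[OF bm,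
            where A = "\<lambda>n. A (Suc n)" and k = "\<lambda>n. k (Suc n)"]) auto
    then show ?b using esssup by simp
  qed
  have bS: "?b \<Longrightarrow> ?S" using mix by blast
  show ?thesis using mix Sa ad dc cb bS by blast
qed

end
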